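(* If a formula $\Phi(x)$ satisfies $\mathbf{D1}$ and $\mathbf{B}_2^U$, then it satisfies $\Sigma_1\text{-}\mathbf{C}^U$; that is, for every $\Sigma_1$ formula $\varphi(\vec x)$, $S\vdash\forall\vec x\,(\varphi(\vec x)\to\Phi(\ulcorner\varphi(\vec{\dot x})\urcorner))$.
   Context: $\mathcal{L}_A$ is the language of first-order arithmetic containing $0,\mathsf{s},+,\times$ (and possibly function symbols for some primitive recursive functions); numerals are $\overline{n}=\mathsf{s}(\cdots\mathsf{s}(0)\cdots)$ ($n$ times). $\mathsf{PA}$ is Peano Arithmetic. $S$ and $T$ are recursively axiomatized consistent extensions of $\mathsf{PA}$ in $\mathcal{L}_A$, and $T$ extends $S$. A natural Gödel numbering is fixed; $\ulcorner\varphi\urcorner$ is the numeral of the Gödel number of $\varphi$, and for a formula $\varphi(\vec x)$, $\ulcorner\varphi(\vec{\dot x})\urcorner$ is a primitive recursive term which, for values $\vec n$ of $\vec x$, gives the Gödel number of $\varphi(\overline{\vec n})$. $\Phi(x)$ is an arbitrary formula with one free variable. Conditions: $\mathbf{D1}$: for every formula $\varphi$, if $T\vdash\varphi$ then $S\vdash\Phi(\ulcorner\varphi\urcorner)$. $\mathbf{B}_2^U$: for all formulas $\varphi(\vec x),\psi(\vec x)$, if $T\vdash\forall\vec x(\varphi(\vec x)\to\psi(\vec x))$ then $S\vdash\forall\vec x(\Phi(\ulcorner\varphi(\vec{\dot x})\urcorner)\to\Phi(\ulcorner\psi(\vec{\dot x})\urcorner))$. *)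

theory Defs
  imports Main "HOL-Library.Nat_Bijection"
begin

section \<open>Primitive recursive function symbols\<close>

text \<open>
  A function symbol is a description of a primitive recursive function. The first argument of
  \<^term>\<open>PRec g h\<close> is the recursion argument: \<open>f(0, xs) = g(xs)\<close> and
  \<open>f(y + 1, xs) = h(y, f(y, xs), xs)\<close>. \<^term>\<open>PComp n g hs\<close> carries its arity \<open>n\<close> because \<open>hs\<close> may be
  empty.
\<close>

datatype pfun =
    PZero nat
  | PSucc
  | PProj nat nat
  | PComp nat pfun "pfun list"
  | PRec pfun pfun

primrec arity :: "pfun \<Rightarrow> nat" where
  "arity (PZero n) = n"
| "arity PSucc = 1"
| "arity (PProj n i) = n"
| "arity (PComp n g hs) = n"
| "arity (PRec g h) = Suc (arity g)"

fun wf_pf :: "pfun \<Rightarrow> bool" where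
  "wf_pf (PZero n) = True"
| "wf_pf PSucc = True"
| "wf_pf (PProj n i) = (i < n)"
| "wf_pf (PComp n g hs) =
     (wf_pf g \<and> length hs = arity g \<and> (\<forall>h\<in>set hs. wf_pf h \<and> arity h = n))"
| "wf_pf (PRec g h) = (wf_pf g \<and> wf_pf h \<and> arity h = arity g + 2)"

fun peval :: "pfun \<Rightarrow> nat list \<Rightarrow> nat" where
  "peval (PZero n) xs = 0"
| "peval PSucc xs = Suc (hd xs)"
| "peval (PProj n i) xs = xs ! i"
| "peval (PComp n g hs) xs = peval g (map (\<lambda>h. peval h xs) hs)"
| "peval (PRec g h) xs =
     rec_nat (peval g (tl xs)) (\<lambda>y r. peval h (y # r # tl xs)) (hd xs)"

fun constituents :: "pfun \<Rightarrow> pfun set" where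
  "constituents (PComp n g hs) = insert g (set hs)"
| "constituents (PRec g h) = {g, h}"
| "constituents _ = {}"


section \<open>Terms and formulas, with de Bruijn indices\<close>

datatype tm =
    Var nat
  | Zero
  | Succ tm
  | Add tm tm
  | Mul tm tm
  | Fn pfun "tm list"

datatype fm =
    Equal tm tm
  | Falsum
  | Conj fm fm
  | Disj fm fm
  | Impl fm fm
  | Forall fm
  | Exists fm

abbreviation Neg :: "fm \<Rightarrow> fm" where
  "Neg \<phi> \<equiv> Impl \<phi> Falsum"

fun numeral_tm :: "nat \<Rightarrow> tm" where
  "numeral_tm 0 = Zero"
| "numeral_tm (Suc n) = Succ (numeral_tm n)"

fun fv_tm :: "tm \<Rightarrow> nat set" where
  "fv_tm (Var i) = {i}"
| "fv_tm Zero = {}"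
| "fv_tm (Succ t) = fv_tm t"
| "fv_tm (Add t u) = fv_tm t \<union> fv_tm u"
| "fv_tm (Mul t u) = fv_tm t \<union> fv_tm u"
| "fv_tm (Fn f ts) = (\<Union>t\<in>set ts. fv_tm t)"

fun fv :: "fm \<Rightarrow> nat set" where
  "fv (Equal t u) = fv_tm t \<union> fv_tm u"
| "fv Falsum = {}"
| "fv (Conj \<phi> \<psi>) = fv \<phi> \<union> fv \<psi>"
| "fv (Disj \<phi> \<psi>) = fv \<phi> \<union> fv \<psi>"
| "fv (Impl \<phi> \<psi>) = fv \<phi> \<union> fv \<psi>"
| "fv (Forall \<phi>) = {i. Suc i \<in> fv \<phi>}"
| "fv (Exists \<phi>) = {i. Suc i \<in> fv \<phi>}"

fun subst_tm :: "(nat \<Rightarrow> tm) \<Rightarrow> tm \<Rightarrow> tm" where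
  "subst_tm \<sigma> (Var i) = \<sigma> i"
| "subst_tm \<sigma> Zero = Zero"
| "subst_tm \<sigma> (Succ t) = Succ (subst_tm \<sigma> t)"
| "subst_tm \<sigma> (Add t u) = Add (subst_tm \<sigma> t) (subst_tm \<sigma> u)"
| "subst_tm \<sigma> (Mul t u) = Mul (subst_tm \<sigma> t) (subst_tm \<sigma> u)"
| "subst_tm \<sigma> (Fn f ts) = Fn f (map (subst_tm \<sigma>) ts)"

definition lift_tm :: "tm \<Rightarrow> tm" where
  "lift_tm = subst_tm (\<lambda>i. Var (Suc i))"

definition up :: "(nat \<Rightarrow> tm) \<Rightarrow> nat \<Rightarrow> tm" where
  "up \<sigma> = case_nat (Var 0) (\<lambda>i. lift_tm (\<sigma> i))"

fun subst :: "(nat \<Rightarrow> tm) \<Rightarrow> fm \<Rightarrow> fm" where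
  "subst \<sigma> (Equal t u) = Equal (subst_tm \<sigma> t) (subst_tm \<sigma> u)"
| "subst \<sigma> Falsum = Falsum"
| "subst \<sigma> (Conj \<phi> \<psi>) = Conj (subst \<sigma> \<phi>) (subst \<sigma> \<psi>)"
| "subst \<sigma> (Disj \<phi> \<psi>) = Disj (subst \<sigma> \<phi>) (subst \<sigma> \<psi>)"
| "subst \<sigma> (Impl \<phi> \<psi>) = Impl (subst \<sigma> \<phi>) (subst \<sigma> \<psi>)"
| "subst \<sigma> (Forall \<phi>) = Forall (subst (up \<sigma>) \<phi>)"
| "subst \<sigma> (Exists \<phi>) = Exists (subst (up \<sigma>) \<phi>)"

definition lift :: "fm \<Rightarrow> fm" where
  "lift = subst (\<lambda>i. Var (Suc i))"

text \<open>\<open>inst \<phi> t\<close> is \<open>\<phi>(t)\<close>, where the distinguished variable of \<open>\<phi>\<close> is the one with index 0.\<close>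

definition inst :: "fm \<Rightarrow> tm \<Rightarrow> fm" where
  "inst \<phi> t = subst (case_nat t Var) \<phi>"

text \<open>\<open>alls n \<phi>\<close> binds the variables with indices below \<open>n\<close>.\<close>

definition alls :: "nat \<Rightarrow> fm \<Rightarrow> fm" where
  "alls n \<phi> = (Forall ^^ n) \<phi>"


section \<open>The language with function symbols \<open>F\<close>, and provability\<close>

text \<open>
  The language consists of \<open>0\<close>, \<open>s\<close>, \<open>+\<close>, \<open>\<times>\<close> and the primitive recursive function symbols in \<open>F\<close>.
\<close>

fun wf_tm :: "pfun set \<Rightarrow> tm \<Rightarrow> bool" where
  "wf_tm F (Var i) = True"
| "wf_tm F Zero = True"
| "wf_tm F (Succ t) = wf_tm F t"
| "wf_tm F (Add t u) = (wf_tm F t \<and> wf_tm F u)"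
| "wf_tm F (Mul t u) = (wf_tm F t \<and> wf_tm F u)"
| "wf_tm F (Fn f ts) = (f \<in> F \<and> length ts = arity f \<and> (\<forall>t\<in>set ts. wf_tm F t))"

fun wf_fm :: "pfun set \<Rightarrow> fm \<Rightarrow> bool" where
  "wf_fm F (Equal t u) = (wf_tm F t \<and> wf_tm F u)"
| "wf_fm F Falsum = True"
| "wf_fm F (Conj \<phi> \<psi>) = (wf_fm F \<phi> \<and> wf_fm F \<psi>)"
| "wf_fm F (Disj \<phi> \<psi>) = (wf_fm F \<phi> \<and> wf_fm F \<psi>)"
| "wf_fm F (Impl \<phi> \<psi>) = (wf_fm F \<phi> \<and> wf_fm F \<psi>)"
| "wf_fm F (Forall \<phi>) = wf_fm F \<phi>"
| "wf_fm F (Exists \<phi>) = wf_fm F \<phi>"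

text \<open>
  Natural deduction for classical first-order logic with equality. The side conditions keep every
  formula of a derivation inside the language.
\<close>

inductive deriv :: "pfun set \<Rightarrow> fm set \<Rightarrow> fm \<Rightarrow> bool" for F where
  Assm: "\<phi> \<in> \<Gamma> \<Longrightarrow> wf_fm F \<phi> \<Longrightarrow> deriv F \<Gamma> \<phi>"
| Classical: "deriv F (insert (Neg \<phi>) \<Gamma>) Falsum \<Longrightarrow> wf_fm F \<phi> \<Longrightarrow> deriv F \<Gamma> \<phi>"
| ConjI: "deriv F \<Gamma> \<phi> \<Longrightarrow> deriv F \<Gamma> \<psi> \<Longrightarrow> deriv F \<Gamma> (Conj \<phi> \<psi>)"
| ConjE1: "deriv F \<Gamma> (Conj \<phi> \<psi>) \<Longrightarrow> deriv F \<Gamma> \<phi>"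
| ConjE2: "deriv F \<Gamma> (Conj \<phi> \<psi>) \<Longrightarrow> deriv F \<Gamma> \<psi>"
| DisjI1: "deriv F \<Gamma> \<phi> \<Longrightarrow> wf_fm F \<psi> \<Longrightarrow> deriv F \<Gamma> (Disj \<phi> \<psi>)"
| DisjI2: "deriv F \<Gamma> \<psi> \<Longrightarrow> wf_fm F \<phi> \<Longrightarrow> deriv F \<Gamma> (Disj \<phi> \<psi>)"
| DisjE: "deriv F \<Gamma> (Disj \<phi> \<psi>) \<Longrightarrow> deriv F (insert \<phi> \<Gamma>) \<chi> \<Longrightarrow> deriv F (insert \<psi> \<Gamma>) \<chi>
    \<Longrightarrow> deriv F \<Gamma> \<chi>"
| ImplI: "deriv F (insert \<phi> \<Gamma>) \<psi> \<Longrightarrow> wf_fm F \<phi> \<Longrightarrow> deriv F \<Gamma> (Impl \<phi> \<psi>)"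
| ImplE: "deriv F \<Gamma> (Impl \<phi> \<psi>) \<Longrightarrow> deriv F \<Gamma> \<phi> \<Longrightarrow> deriv F \<Gamma> \<psi>"
| ForallI: "deriv F (lift ` \<Gamma>) \<phi> \<Longrightarrow> deriv F \<Gamma> (Forall \<phi>)"
| ForallE: "deriv F \<Gamma> (Forall \<phi>) \<Longrightarrow> wf_tm F t \<Longrightarrow> deriv F \<Gamma> (inst \<phi> t)"
| ExistsI: "deriv F \<Gamma> (inst \<phi> t) \<Longrightarrow> wf_tm F t \<Longrightarrow> wf_fm F \<phi> \<Longrightarrow> deriv F \<Gamma> (Exists \<phi>)"
| ExistsE: "deriv F \<Gamma> (Exists \<phi>) \<Longrightarrow> deriv F (insert \<phi> (lift ` \<Gamma>)) (lift \<chi>) \<Longrightarrow> wf_fm F \<chi>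
    \<Longrightarrow> deriv F \<Gamma> \<chi>"
| EqualI: "wf_tm F t \<Longrightarrow> deriv F \<Gamma> (Equal t t)"
| EqualE: "deriv F \<Gamma> (Equal t u) \<Longrightarrow> deriv F \<Gamma> (inst \<phi> t) \<Longrightarrow> wf_fm F \<phi> \<Longrightarrow> deriv F \<Gamma> (inst \<phi> u)"

text \<open>A theory is given by its set of non-logical axioms, which are sentences of the language.\<close>

definition is_theory :: "pfun set \<Rightarrow> fm set \<Rightarrow> bool" where
  "is_theory F T \<longleftrightarrow> (\<forall>\<phi>\<in>T. wf_fm F \<phi> \<and> fv \<phi> = {})"

definition consistent :: "pfun set \<Rightarrow> fm set \<Rightarrow> bool" where
  "consistent F T \<longleftrightarrow> \<not> deriv F T Falsum"

definition extends :: "pfun set \<Rightarrow> fm set \<Rightarrow> fm set \<Rightarrow> bool" where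
  "extends F T S \<longleftrightarrow> (\<forall>\<phi>. deriv F S \<phi> \<longrightarrow> deriv F T \<phi>)"


section \<open>Peano arithmetic\<close>

fun defining_axioms :: "pfun \<Rightarrow> fm set" where
  "defining_axioms (PZero n) =
     {alls n (Equal (Fn (PZero n) (map Var [0..<n])) Zero)}"
| "defining_axioms PSucc =
     {alls 1 (Equal (Fn PSucc [Var 0]) (Succ (Var 0)))}"
| "defining_axioms (PProj n i) =
     {alls n (Equal (Fn (PProj n i) (map Var [0..<n])) (Var i))}"
| "defining_axioms (PComp n g hs) =
     {alls n (Equal (Fn (PComp n g hs) (map Var [0..<n]))
                    (Fn g (map (\<lambda>h. Fn h (map Var [0..<n])) hs)))}"
| "defining_axioms (PRec g h) =
     (let n = arity g; xs = map Var [0..<n]; ys = map Var [1..<Suc n] in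
      {alls n (Equal (Fn (PRec g h) (Zero # xs)) (Fn g xs)),
       alls (Suc n) (Equal (Fn (PRec g h) (Succ (Var 0) # ys))
                           (Fn h (Var 0 # Fn (PRec g h) (Var 0 # ys) # ys)))})"

text \<open>
  In the induction formula the induction variable has index 0; the conclusion of the step
  substitutes its successor for it and leaves the parameters unchanged.
\<close>

definition induction_fm :: "fm \<Rightarrow> fm" where
  "induction_fm \<phi> =
     Impl (inst \<phi> Zero)
       (Impl (Forall (Impl \<phi> (subst (case_nat (Succ (Var 0)) (\<lambda>i. Var (Suc i))) \<phi>)))
         (Forall \<phi>))"

definition PA :: "pfun set \<Rightarrow> fm set" where
  "PA F =
     {alls 1 (Neg (Equal (Succ (Var 0)) Zero)),
      alls 2 (Impl (Equal (Succ (Var 0)) (Succ (Var 1))) (Equal (Var 0) (Var 1))),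
      alls 1 (Equal (Add (Var 0) Zero) (Var 0)),
      alls 2 (Equal (Add (Var 0) (Succ (Var 1))) (Succ (Add (Var 0) (Var 1)))),
      alls 1 (Equal (Mul (Var 0) Zero) Zero),
      alls 2 (Equal (Mul (Var 0) (Succ (Var 1))) (Add (Mul (Var 0) (Var 1)) (Var 0)))}
   \<union> (\<Union>f\<in>F. defining_axioms f)
   \<union> {alls n (induction_fm \<phi>) | n \<phi>. wf_fm F \<phi> \<and> fv (Forall \<phi>) \<subseteq> {..<n}}"


section \<open>Arithmetical hierarchy\<close>

definition leq :: "tm \<Rightarrow> tm \<Rightarrow> fm" where
  "leq t u = Exists (Equal (Add (Var 0) (lift_tm t)) (lift_tm u))"

definition lt :: "tm \<Rightarrow> tm \<Rightarrow> fm" where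
  "lt t u = leq (Succ t) u"

text \<open>
  Since the language has no order symbol, \<open>t \<le> u\<close> and \<open>t < u\<close> are abbreviations, and they count as
  bounded. Lifting the bound \<open>t\<close> expresses that the quantified variable does not occur in it.
\<close>

inductive Delta0 :: "fm \<Rightarrow> bool" where
  "Delta0 (Equal t u)"
| "Delta0 (leq t u)"
| "Delta0 (lt t u)"
| "Delta0 Falsum"
| "Delta0 \<phi> \<Longrightarrow> Delta0 \<psi> \<Longrightarrow> Delta0 (Conj \<phi> \<psi>)"
| "Delta0 \<phi> \<Longrightarrow> Delta0 \<psi> \<Longrightarrow> Delta0 (Disj \<phi> \<psi>)"
| "Delta0 \<phi> \<Longrightarrow> Delta0 \<psi> \<Longrightarrow> Delta0 (Impl \<phi> \<psi>)"
| "Delta0 \<phi> \<Longrightarrow> Delta0 (Forall (Impl (leq (Var 0) (lift_tm t)) \<phi>))"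
| "Delta0 \<phi> \<Longrightarrow> Delta0 (Forall (Impl (lt (Var 0) (lift_tm t)) \<phi>))"
| "Delta0 \<phi> \<Longrightarrow> Delta0 (Exists (Conj (leq (Var 0) (lift_tm t)) \<phi>))"
| "Delta0 \<phi> \<Longrightarrow> Delta0 (Exists (Conj (lt (Var 0) (lift_tm t)) \<phi>))"

inductive Sigma1 :: "fm \<Rightarrow> bool" where
  "Delta0 \<phi> \<Longrightarrow> Sigma1 \<phi>"
| "Sigma1 \<phi> \<Longrightarrow> Sigma1 (Exists \<phi>)"


section \<open>Goedel numbering\<close>

abbreviation pair :: "nat \<Rightarrow> nat \<Rightarrow> nat" where
  "pair m n \<equiv> prod_encode (m, n)"

fun gn_pf :: "pfun \<Rightarrow> nat" where
  "gn_pf (PZero n) = pair 0 n"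
| "gn_pf PSucc = pair 1 0"
| "gn_pf (PProj n i) = pair 2 (pair n i)"
| "gn_pf (PComp n g hs) = pair 3 (pair n (pair (gn_pf g) (list_encode (map gn_pf hs))))"
| "gn_pf (PRec g h) = pair 4 (pair (gn_pf g) (gn_pf h))"

fun gn_tm :: "tm \<Rightarrow> nat" where
  "gn_tm (Var i) = pair 0 i"
| "gn_tm Zero = pair 1 0"
| "gn_tm (Succ t) = pair 2 (gn_tm t)"
| "gn_tm (Add t u) = pair 3 (pair (gn_tm t) (gn_tm u))"
| "gn_tm (Mul t u) = pair 4 (pair (gn_tm t) (gn_tm u))"
| "gn_tm (Fn f ts) = pair 5 (pair (gn_pf f) (list_encode (map gn_tm ts)))"

fun gn :: "fm \<Rightarrow> nat" where
  "gn (Equal t u) = pair 0 (pair (gn_tm t) (gn_tm u))"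
| "gn Falsum = pair 1 0"
| "gn (Conj \<phi> \<psi>) = pair 2 (pair (gn \<phi>) (gn \<psi>))"
| "gn (Disj \<phi> \<psi>) = pair 3 (pair (gn \<phi>) (gn \<psi>))"
| "gn (Impl \<phi> \<psi>) = pair 4 (pair (gn \<phi>) (gn \<psi>))"
| "gn (Forall \<phi>) = pair 5 (gn \<phi>)"
| "gn (Exists \<phi>) = pair 6 (gn \<phi>)"

definition quote :: "fm \<Rightarrow> tm" where
  "quote \<phi> = numeral_tm (gn \<phi>)"


section \<open>Total recursive functions and recursive axiomatizations\<close>

inductive recfn :: "nat \<Rightarrow> (nat list \<Rightarrow> nat) \<Rightarrow> bool" where
  rf_zero: "recfn n (\<lambda>xs. 0)"
| rf_succ: "recfn 1 (\<lambda>xs. Suc (hd xs))"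
| rf_proj: "i < n \<Longrightarrow> recfn n (\<lambda>xs. xs ! i)"
| rf_comp: "recfn (length hs) g \<Longrightarrow> \<forall>h\<in>set hs. recfn n h
    \<Longrightarrow> recfn n (\<lambda>xs. g (map (\<lambda>h. h xs) hs))"
| rf_rec: "recfn n g \<Longrightarrow> recfn (n + 2) h
    \<Longrightarrow> recfn (Suc n) (\<lambda>xs. rec_nat (g (tl xs)) (\<lambda>y r. h (y # r # tl xs)) (hd xs))"
| rf_min: "recfn (Suc n) f \<Longrightarrow> \<forall>xs. length xs = n \<longrightarrow> (\<exists>y. f (y # xs) = 0)
    \<Longrightarrow> recfn n (\<lambda>xs. LEAST y. f (y # xs) = 0)"

definition recursive_set :: "nat set \<Rightarrow> bool" where
  "recursive_set A \<longleftrightarrow> (\<exists>f. recfn 1 f \<and> (\<forall>x. f [x] = (if x \<in> A then 1 else 0)))"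

definition recursively_axiomatized :: "fm set \<Rightarrow> bool" where
  "recursively_axiomatized T \<longleftrightarrow> recursive_set (gn ` T)"


section \<open>Dotted Goedel number terms\<close>

fun const_pf :: "nat \<Rightarrow> nat \<Rightarrow> pfun" where
  "const_pf n 0 = PZero n"
| "const_pf n (Suc k) = PComp n PSucc [const_pf n k]"

definition add_pf :: pfun where
  "add_pf = PRec (PProj 1 0) (PComp 3 PSucc [PProj 3 1])"

definition triangle_pf :: pfun where
  "triangle_pf = PRec (PZero 0) (PComp 2 PSucc [PComp 2 add_pf [PProj 2 0, PProj 2 1]])"

definition pair_pf :: pfun where
  "pair_pf = PComp 2 add_pf [PComp 2 triangle_pf [add_pf], PProj 2 0]"

text \<open>The Goedel number of the numeral of \<open>x\<close>, as a function of \<open>x\<close>.\<close>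

definition num_pf :: pfun where
  "num_pf = PRec (const_pf 0 (gn_tm Zero)) (PComp 2 pair_pf [const_pf 2 2, PProj 2 1])"

abbreviation pair_tm :: "tm \<Rightarrow> tm \<Rightarrow> tm" where
  "pair_tm t u \<equiv> Fn pair_pf [t, u]"

fun list_tm :: "tm list \<Rightarrow> tm" where
  "list_tm [] = Zero"
| "list_tm (t # ts) = Succ (pair_tm t (list_tm ts))"

text \<open>
  \<open>dot_fm 0 \<phi>\<close> is the term \<open>\<ulcorner>\<phi>(\<dots>)\<urcorner>\<close> in which every free variable of \<open>\<phi>\<close> is dotted. The first
  argument of \<open>dot_tm\<close> and \<open>dot_fm\<close> is the number of quantifiers passed: a variable bound by one of
  them is coded as itself, any other variable by the code of the numeral of its value.
\<close>

fun dot_tm :: "nat \<Rightarrow> tm \<Rightarrow> tm" where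
  "dot_tm k (Var i) = (if i < k then numeral_tm (gn_tm (Var i)) else Fn num_pf [Var (i - k)])"
| "dot_tm k Zero = numeral_tm (gn_tm Zero)"
| "dot_tm k (Succ t) = pair_tm (numeral_tm 2) (dot_tm k t)"
| "dot_tm k (Add t u) = pair_tm (numeral_tm 3) (pair_tm (dot_tm k t) (dot_tm k u))"
| "dot_tm k (Mul t u) = pair_tm (numeral_tm 4) (pair_tm (dot_tm k t) (dot_tm k u))"
| "dot_tm k (Fn f ts) =
     pair_tm (numeral_tm 5) (pair_tm (numeral_tm (gn_pf f)) (list_tm (map (dot_tm k) ts)))"

fun dot_fm :: "nat \<Rightarrow> fm \<Rightarrow> tm" where
  "dot_fm k (Equal t u) = pair_tm (numeral_tm 0) (pair_tm (dot_tm k t) (dot_tm k u))"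
| "dot_fm k Falsum = numeral_tm (gn Falsum)"
| "dot_fm k (Conj \<phi> \<psi>) = pair_tm (numeral_tm 2) (pair_tm (dot_fm k \<phi>) (dot_fm k \<psi>))"
| "dot_fm k (Disj \<phi> \<psi>) = pair_tm (numeral_tm 3) (pair_tm (dot_fm k \<phi>) (dot_fm k \<psi>))"
| "dot_fm k (Impl \<phi> \<psi>) = pair_tm (numeral_tm 4) (pair_tm (dot_fm k \<phi>) (dot_fm k \<psi>))"
| "dot_fm k (Forall \<phi>) = pair_tm (numeral_tm 5) (dot_fm (Suc k) \<phi>)"
| "dot_fm k (Exists \<phi>) = pair_tm (numeral_tm 6) (dot_fm (Suc k) \<phi>)"

definition dot_quote :: "fm \<Rightarrow> tm" where
  "dot_quote \<phi> = dot_fm 0 \<phi>"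

text \<open>
  A language is admissible if its function symbols are well-formed, come with the symbols that occur
  in their defining equations, and suffice for the terms \<open>dot_quote \<phi>\<close>.
\<close>

definition admissible :: "pfun set \<Rightarrow> bool" where
  "admissible F \<longleftrightarrow>
     (\<forall>f\<in>F. wf_pf f \<and> constituents f \<subseteq> F) \<and> pair_pf \<in> F \<and> num_pf \<in> F"


section \<open>Derivability conditions\<close>

definition D1 :: "pfun set \<Rightarrow> fm set \<Rightarrow> fm set \<Rightarrow> fm \<Rightarrow> bool" where
  "D1 F S T \<Phi> \<longleftrightarrow> (\<forall>\<phi>. wf_fm F \<phi> \<longrightarrow> deriv F T \<phi> \<longrightarrow> deriv F S (inst \<Phi> (quote \<phi>)))"

definition B2U :: "pfun set \<Rightarrow> fm set \<Rightarrow> fm set \<Rightarrow> fm \<Rightarrow> bool" where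
  "B2U F S T \<Phi> \<longleftrightarrow>
     (\<forall>n \<phi> \<psi>. wf_fm F \<phi> \<longrightarrow> wf_fm F \<psi> \<longrightarrow> fv \<phi> \<subseteq> {..<n} \<longrightarrow> fv \<psi> \<subseteq> {..<n} \<longrightarrow>
        deriv F T (alls n (Impl \<phi> \<psi>)) \<longrightarrow>
        deriv F S (alls n (Impl (inst \<Phi> (dot_quote \<phi>)) (inst \<Phi> (dot_quote \<psi>)))))"

definition Sigma1_CU :: "pfun set \<Rightarrow> fm set \<Rightarrow> fm \<Rightarrow> bool" where
  "Sigma1_CU F S \<Phi> \<longleftrightarrow>
     (\<forall>n \<phi>. wf_fm F \<phi> \<longrightarrow> Sigma1 \<phi> \<longrightarrow> fv \<phi> \<subseteq> {..<n} \<longrightarrow>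
        deriv F S (alls n (Impl \<phi> (inst \<Phi> (dot_quote \<phi>)))))"


section \<open>Adequacy of the coding\<close>

fun eval_tm :: "(nat \<Rightarrow> nat) \<Rightarrow> tm \<Rightarrow> nat" where
  "eval_tm e (Var i) = e i"
| "eval_tm e Zero = 0"
| "eval_tm e (Succ t) = Suc (eval_tm e t)"
| "eval_tm e (Add t u) = eval_tm e t + eval_tm e u"
| "eval_tm e (Mul t u) = eval_tm e t * eval_tm e u"
| "eval_tm e (Fn f ts) = peval f (map (eval_tm e) ts)"

lemma eval_numeral_tm [simp]: "eval_tm e (numeral_tm n) = n"
  by (induction n) auto

lemma subst_numeral_tm [simp]: "subst_tm \<sigma> (numeral_tm n) = numeral_tm n"
  by (induction n) auto

lemma lift_numeral_tm [simp]: "lift_tm (numeral_tm n) = numeral_tm n"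
  by (simp add: lift_tm_def)

lemma peval_const_pf [simp]: "peval (const_pf n k) xs = k"
  by (induction k) auto

lemma peval_add_pf [simp]: "peval add_pf [x, y] = x + y"
  by (induction x) (auto simp: add_pf_def)

lemma peval_triangle_pf [simp]: "peval triangle_pf [x] = triangle x"
  by (induction x) (auto simp: triangle_pf_def)

lemma peval_pair_pf [simp]: "peval pair_pf [x, y] = pair x y"
  by (simp add: pair_pf_def prod_encode_def)

lemma peval_num_pf [simp]: "peval num_pf [x] = gn_tm (numeral_tm x)"
  by (induction x) (auto simp: num_pf_def)

lemma eval_list_tm [simp]: "eval_tm e (list_tm ts) = list_encode (map (eval_tm e) ts)"
  by (induction ts) auto

lemma eval_dot_tm:
  assumes "\<And>i. i < k \<Longrightarrow> \<sigma> i = Var i"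
    and "\<And>i. \<sigma> (i + k) = numeral_tm (e i)"
  shows "eval_tm e (dot_tm k t) = gn_tm (subst_tm \<sigma> t)"
proof (induction t)
  case (Var i)
  show ?case
    using assms(1)[of i] assms(2)[of "i - k"] by (cases "i < k") simp_all
qed (simp_all cong: map_cong)

lemma eval_dot_fm:
  assumes "\<And>i. i < k \<Longrightarrow> \<sigma> i = Var i"
    and "\<And>i. \<sigma> (i + k) = numeral_tm (e i)"
  shows "eval_tm e (dot_fm k \<phi>) = gn (subst \<sigma> \<phi>)"
  using assms
proof (induction \<phi> arbitrary: k \<sigma>)
  case (Equal t u)
  then show ?case by (simp add: eval_dot_tm)
next
  case (Forall \<phi>)
  have "eval_tm e (dot_fm (Suc k) \<phi>) = gn (subst (up \<sigma>) \<phi>)"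
    by (rule Forall.IH) (auto simp: up_def Forall.prems lift_tm_def split: nat.split)
  then show ?case by simp
next
  case (Exists \<phi>)
  have "eval_tm e (dot_fm (Suc k) \<phi>) = gn (subst (up \<sigma>) \<phi>)"
    by (rule Exists.IH) (auto simp: up_def Exists.prems lift_tm_def split: nat.split)
  then show ?case by simp
qed simp_all

theorem eval_dot_quote:
  "eval_tm e (dot_quote \<phi>) = gn (subst (\<lambda>i. numeral_tm (e i)) \<phi>)"
  unfolding dot_quote_def by (rule eval_dot_fm) simp_all

lemma gn_pf_inject: "gn_pf f = gn_pf g \<longleftrightarrow> f = g"
proof (induction f arbitrary: g)
  case (PComp n f hs)
  have "map gn_pf hs = map gn_pf hs' \<longleftrightarrow> hs = hs'" for hs'
    using PComp.IH(2) by (auto intro: list.inj_map_strong)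
  with PComp.IH(1) show ?case by (cases g) (auto simp: list_encode_eq)
next
  case (PZero n)
  show ?case by (cases g) auto
next
  case PSucc
  show ?case by (cases g) auto
next
  case (PProj n i)
  show ?case by (cases g) auto
next
  case (PRec f h)
  then show ?case by (cases g) auto
qed

lemma gn_tm_inject: "gn_tm t = gn_tm u \<longleftrightarrow> t = u"
proof (induction t arbitrary: u)
  case (Fn f ts)
  have "map gn_tm ts = map gn_tm ts' \<longleftrightarrow> ts = ts'" for ts'
    using Fn.IH by (auto intro: list.inj_map_strong)
  then show ?case by (cases u) (auto simp: gn_pf_inject list_encode_eq)
next
  case (Var i)
  show ?case by (cases u) auto
next
  case Zero
  show ?case by (cases u) auto
next
  case (Succ t)
  then show ?case by (cases u) auto
next
  case (Add t t')
  then show ?case by (cases u) auto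
next
  case (Mul t t')
  then show ?case by (cases u) auto
qed

theorem gn_inject: "gn \<phi> = gn \<psi> \<longleftrightarrow> \<phi> = \<psi>"
proof (induction \<phi> arbitrary: \<psi>)
  case (Equal t u)
  show ?case by (cases \<psi>) (auto simp: gn_tm_inject)
next
  case Falsum
  show ?case by (cases \<psi>) auto
next
  case (Conj \<phi>1 \<phi>2)
  then show ?case by (cases \<psi>) auto
next
  case (Disj \<phi>1 \<phi>2)
  then show ?case by (cases \<psi>) auto
next
  case (Impl \<phi>1 \<phi>2)
  then show ?case by (cases \<psi>) auto
next
  case (Forall \<phi>)
  then show ?case by (cases \<psi>) auto
next
  case (Exists \<phi>)
  then show ?case by (cases \<psi>) auto
qed

lemma admissible_all: "admissible {f. wf_pf f}"
proof -
  have "wf_pf (const_pf n k) \<and> arity (const_pf n k) = n" for n k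
    by (induction k) auto
  moreover have "constituents f \<subseteq> {f. wf_pf f}" if "wf_pf f" for f
    using that by (cases f) auto
  ultimately show ?thesis
    by (auto simp: admissible_def num_pf_def pair_pf_def triangle_pf_def add_pf_def)
qed

end

theory Submission
  imports Defs "HOL-Library.Countable_Set"
begin

text \<open>
  By the completeness theorem it suffices to argue in a model \<open>M\<close> of \<open>S\<close>. There \<open>\<Phi>\<close> is a set of
  codes, and \<open>B\<^sub>2\<^sup>U\<close> says that this set is closed under implications provable in \<open>T\<close>, with
  nonstandard numerals for the variables. Nothing makes it closed under conjunction, so the usual
  induction on \<open>\<phi>\<close> is applied to a stronger claim: for every side formula \<open>\<psi>\<close>, if \<open>\<phi>\<close> holds in \<open>M\<close>
  and \<open>\<psi>\<close> is provable, then \<open>\<psi> \<and> \<phi>\<close> is provable. This claim is closed under conjunction,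
  disjunction, existential and, by induction inside \<open>M\<close>, bounded universal quantification; another
  induction inside \<open>M\<close> evaluates the primitive recursive terms. Negations in \<open>\<Delta>\<^sub>0\<close> formulas are
  pushed down to equations, where they become disjunctions of strict inequalities. Finally \<open>D1\<close>
  makes a tautology provable, which serves as the first side formula.
\<close>

section \<open>Substitution\<close>

lemma subst_tm_subst_tm: "subst_tm \<sigma> (subst_tm \<tau> t) = subst_tm (\<lambda>i. subst_tm \<sigma> (\<tau> i)) t"
  by (induction t) simp_all

lemma subst_tm_cong: "(\<And>i. i \<in> fv_tm t \<Longrightarrow> \<sigma> i = \<tau> i) \<Longrightarrow> subst_tm \<sigma> t = subst_tm \<tau> t"
  by (induction t) auto

lemma subst_tm_Var [simp]: "subst_tm Var t = t"
  by (induction t) (simp_all add: map_idI)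

lemma up_0 [simp]: "up \<sigma> 0 = Var 0"
  and up_Suc [simp]: "up \<sigma> (Suc i) = lift_tm (\<sigma> i)"
  by (simp_all add: up_def)

lemma lift_tm_Var [simp]: "lift_tm (Var i) = Var (Suc i)"
  by (simp add: lift_tm_def)

lemma up_Var [simp]: "up Var = Var"
  by (rule ext) (simp add: up_def split: nat.split)

lemma up_cong: "(\<And>i. Suc i \<in> A \<Longrightarrow> \<sigma> i = \<tau> i) \<Longrightarrow> i \<in> A \<Longrightarrow> up \<sigma> i = up \<tau> i"
  by (cases i) simp_all

lemma subst_tm_up_lift_tm: "subst_tm (up \<sigma>) (lift_tm t) = lift_tm (subst_tm \<sigma> t)"
  by (simp add: lift_tm_def subst_tm_subst_tm up_def)

lemma up_subst_tm: "up (\<lambda>i. subst_tm \<sigma> (\<tau> i)) = (\<lambda>i. subst_tm (up \<sigma>) (up \<tau> i))"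
proof
  show "up (\<lambda>i. subst_tm \<sigma> (\<tau> i)) i = subst_tm (up \<sigma>) (up \<tau> i)" for i
    by (cases i) (simp_all add: subst_tm_up_lift_tm)
qed

lemma subst_Var [simp]: "subst Var \<phi> = \<phi>"
  by (induction \<phi>) simp_all

lemma subst_subst: "subst \<sigma> (subst \<tau> \<phi>) = subst (\<lambda>i. subst_tm \<sigma> (\<tau> i)) \<phi>"
  by (induction \<phi> arbitrary: \<sigma> \<tau>) (simp_all add: subst_tm_subst_tm up_subst_tm)

lemma subst_cong: "(\<And>i. i \<in> fv \<phi> \<Longrightarrow> \<sigma> i = \<tau> i) \<Longrightarrow> subst \<sigma> \<phi> = subst \<tau> \<phi>"
proof (induction \<phi> arbitrary: \<sigma> \<tau>)
  case (Equal t u)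
  then show ?case by (auto intro: subst_tm_cong)
next
  case (Forall \<phi>)
  have "subst (up \<sigma>) \<phi> = subst (up \<tau>) \<phi>"
    by (rule Forall.IH, rule up_cong[where A = "fv \<phi>"]) (simp_all add: Forall.prems)
  then show ?case by simp
next
  case (Exists \<phi>)
  have "subst (up \<sigma>) \<phi> = subst (up \<tau>) \<phi>"
    by (rule Exists.IH, rule up_cong[where A = "fv \<phi>"]) (simp_all add: Exists.prems)
  then show ?case by simp
qed (metis UnCI fv.simps(2-5) subst.simps(2-5))+

lemma subst_sentence: "fv \<phi> = {} \<Longrightarrow> subst \<sigma> \<phi> = \<phi>"
  using subst_cong[of \<phi> \<sigma> Var] by simp

lemma subst_tm_case_nat:
  "(\<lambda>i. subst_tm \<tau> (case_nat t \<sigma> i)) = case_nat (subst_tm \<tau> t) (\<lambda>i. subst_tm \<tau> (\<sigma> i))"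
  by (rule ext) (simp split: nat.split)

lemma subst_tm_case_nat_lift_tm [simp]: "subst_tm (case_nat t \<sigma>) (lift_tm u) = subst_tm \<sigma> u"
  by (simp add: lift_tm_def subst_tm_subst_tm)

lemma subst_case_nat_lift [simp]: "subst (case_nat t \<sigma>) (lift \<phi>) = subst \<sigma> \<phi>"
  by (simp add: lift_def subst_subst)

lemma subst_up_lift: "subst (up \<sigma>) (lift \<phi>) = lift (subst \<sigma> \<phi>)"
  by (simp add: lift_def subst_subst lift_tm_def)

lemma inst_simps [simp]:
  "inst (Equal t u) v = Equal (subst_tm (case_nat v Var) t) (subst_tm (case_nat v Var) u)"
  "inst Falsum v = Falsum"
  "inst (Impl \<phi> \<psi>) v = Impl (inst \<phi> v) (inst \<psi> v)"
  by (simp_all add: inst_def)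

lemma inst_subst_up: "inst (subst (up \<sigma>) \<phi>) t = subst (case_nat t \<sigma>) \<phi>"
  by (simp add: inst_def subst_subst up_def subst_tm_case_nat)

lemma subst_inst: "subst \<sigma> (inst \<phi> t) = inst (subst (up \<sigma>) \<phi>) (subst_tm \<sigma> t)"
  unfolding inst_subst_up by (simp add: inst_def subst_subst subst_tm_case_nat)

definition args :: "tm list \<Rightarrow> nat \<Rightarrow> tm" where
  "args ts i = (if i < length ts then ts ! i else Zero)"

lemma subst_tm_args: "length ts = n \<Longrightarrow> subst_tm (args ts) (Fn f (map Var [0..<n])) = Fn f ts"
  by (auto simp: args_def intro: nth_equalityI)

lemma finite_fv_tm [simp]: "finite (fv_tm t)"
  by (induction t) auto

lemma finite_fv [simp]: "finite (fv \<phi>)"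
proof -
  have "finite {i. Suc i \<in> A}" if "finite A" for A
    using finite_vimageI[OF that, of Suc] by (simp add: vimage_def)
  then show ?thesis by (induction \<phi>) simp_all
qed

lemma fv_bounded: obtains n where "fv \<phi> \<subseteq> {..<n}"
  using finite_fv[of \<phi>] unfolding finite_nat_set_iff_bounded by blast

lemma wf_numeral_tm [simp]: "wf_tm F (numeral_tm n)"
  by (induction n) simp_all

lemma wf_subst_tm [simp]: "(\<And>i. wf_tm F (\<sigma> i)) \<Longrightarrow> wf_tm F (subst_tm \<sigma> t) = wf_tm F t"
  by (induction t) auto

lemma wf_lift_tm [simp]: "wf_tm F (lift_tm t) = wf_tm F t"
  by (simp add: lift_tm_def)

lemma wf_case_nat [simp]: "wf_tm F t \<Longrightarrow> (\<And>i. wf_tm F (\<sigma> i)) \<Longrightarrow> wf_tm F (case_nat t \<sigma> i)"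
  by (cases i) simp_all

lemma wf_up [simp]: "(\<And>i. wf_tm F (\<sigma> i)) \<Longrightarrow> wf_tm F (up \<sigma> i)"
  by (simp add: up_def)

lemma wf_subst [simp]: "(\<And>i. wf_tm F (\<sigma> i)) \<Longrightarrow> wf_fm F (subst \<sigma> \<phi>) = wf_fm F \<phi>"
  by (induction \<phi> arbitrary: \<sigma>) simp_all

lemma wf_lift [simp]: "wf_fm F (lift \<phi>) = wf_fm F \<phi>"
  by (simp add: lift_def)

lemma wf_inst [simp]: "wf_tm F t \<Longrightarrow> wf_fm F (inst \<phi> t) = wf_fm F \<phi>"
  by (simp add: inst_def)

lemma wf_alls [simp]: "wf_fm F (alls n \<phi>) = wf_fm F \<phi>"
  unfolding alls_def by (induction n) simp_all


section \<open>Derivations\<close>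

lemma deriv_imp_wf: "deriv F \<Gamma> \<phi> \<Longrightarrow> wf_fm F \<phi>"
  by (induction rule: deriv.induct) auto

lemma deriv_subst:
  "deriv F \<Gamma> \<phi> \<Longrightarrow> (\<And>i. wf_tm F (\<sigma> i)) \<Longrightarrow> subst \<sigma> ` \<Gamma> \<subseteq> \<Delta> \<Longrightarrow> deriv F \<Delta> (subst \<sigma> \<phi>)"
proof (induction arbitrary: \<sigma> \<Delta> rule: deriv.induct)
  case (Assm \<phi> \<Gamma>)
  then show ?case by (intro deriv.Assm) auto
next
  case (Classical \<phi> \<Gamma>)
  show ?case
    by (rule deriv.Classical, rule Classical.IH[of \<sigma>, simplified]) (use Classical in auto)
next
  case (DisjE \<Gamma> \<phi> \<psi> \<chi>)
  show ?case
    by (rule deriv.DisjE[OF DisjE.IH(1)[of \<sigma>, simplified] DisjE.IH(2,3)]) (use DisjE.prems in auto)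
next
  case (ImplI \<phi> \<Gamma> \<psi>)
  then have "deriv F (insert (subst \<sigma> \<phi>) \<Delta>) (subst \<sigma> \<psi>)" by (intro ImplI.IH) auto
  then show ?case using ImplI by (simp add: deriv.ImplI)
next
  case (ForallI \<Gamma> \<phi>)
  then have "deriv F (lift ` \<Delta>) (subst (up \<sigma>) \<phi>)"
    by (intro ForallI.IH) (auto simp: image_image subst_up_lift)
  then show ?case by (simp add: deriv.ForallI)
next
  case (ForallE \<Gamma> \<phi> t)
  then show ?case by (simp add: subst_inst deriv.ForallE)
next
  case (ExistsI \<Gamma> \<phi> t)
  then show ?case by (simp add: subst_inst deriv.ExistsI[of F _ _ "subst_tm \<sigma> t"])
next
  case (ExistsE \<Gamma> \<phi> \<chi>)
  have "deriv F \<Delta> (Exists (subst (up \<sigma>) \<phi>))" using ExistsE by simp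
  moreover have "deriv F (insert (subst (up \<sigma>) \<phi>) (lift ` \<Delta>)) (subst (up \<sigma>) (lift \<chi>))"
    using ExistsE.prems by (intro ExistsE.IH) (auto simp: image_image subst_up_lift)
  ultimately show ?case
    unfolding subst_up_lift by (rule deriv.ExistsE) (use ExistsE in simp)
next
  case (EqualE \<Gamma> t u \<phi>)
  then have "deriv F \<Delta> (Equal (subst_tm \<sigma> t) (subst_tm \<sigma> u))"
    and "deriv F \<Delta> (inst (subst (up \<sigma>) \<phi>) (subst_tm \<sigma> t))"
    by (simp_all flip: subst_inst)
  then show ?case
    unfolding subst_inst by (rule deriv.EqualE) (use EqualE in simp)
next
  case (ImplE \<Gamma> \<phi> \<psi>)
  then have "deriv F \<Delta> (Impl (subst \<sigma> \<phi>) (subst \<sigma> \<psi>))" "deriv F \<Delta> (subst \<sigma> \<phi>)" by simp_all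
  then show ?case by (rule deriv.ImplE)
qed (auto intro: deriv.ConjI deriv.ConjE1 deriv.ConjE2 deriv.DisjI1 deriv.DisjI2 deriv.EqualI)

lemma deriv_weaken: "deriv F \<Gamma> \<phi> \<Longrightarrow> \<Gamma> \<subseteq> \<Delta> \<Longrightarrow> deriv F \<Delta> \<phi>"
  using deriv_subst[of F \<Gamma> \<phi> Var \<Delta>] by simp

lemma consistent_subset: "consistent F \<Delta> \<Longrightarrow> \<Gamma> \<subseteq> \<Delta> \<Longrightarrow> consistent F \<Gamma>"
  by (auto simp: consistent_def dest: deriv_weaken)

lemma eventually_finite_subsets_insert:
  assumes "\<forall>\<^sub>F B in finite_subsets_at_top (insert a A). P B"
  shows "\<forall>\<^sub>F B in finite_subsets_at_top A. P (insert a B)"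
proof -
  from assms obtain X where "finite X" "X \<subseteq> insert a A"
    and X: "\<forall>B. finite B \<and> X \<subseteq> B \<and> B \<subseteq> insert a A \<longrightarrow> P B"
    unfolding eventually_finite_subsets_at_top by (elim exE conjE)
  moreover have "P (insert a B)" if "finite B" "X - {a} \<subseteq> B" "B \<subseteq> A" for B
    using that by (intro X[rule_format]) auto
  ultimately show ?thesis
    unfolding eventually_finite_subsets_at_top
    by (intro exI[of _ "X - {a}"]) auto
qed

lemma eventually_finite_subsets_image:
  assumes "\<forall>\<^sub>F B in finite_subsets_at_top (f ` A). P B"
  shows "\<forall>\<^sub>F B in finite_subsets_at_top A. P (f ` B)"
proof -
  from assms obtain X where "finite X" "X \<subseteq> f ` A"
    and X: "\<forall>B. finite B \<and> X \<subseteq> B \<and> B \<subseteq> f ` A \<longrightarrow> P B"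
    unfolding eventually_finite_subsets_at_top by (elim exE conjE)
  moreover from finite_subset_image[OF this(1,2)] obtain C where "C \<subseteq> A" "finite C" "X = f ` C"
    by blast
  ultimately show ?thesis
    unfolding eventually_finite_subsets_at_top by (intro exI[of _ C]) (simp add: image_mono)
qed

lemma eventually_deriv_finite_subsets:
  "deriv F \<Gamma> \<phi> \<Longrightarrow> \<forall>\<^sub>F \<Delta> in finite_subsets_at_top \<Gamma>. deriv F \<Delta> \<phi>"
proof (induction rule: deriv.induct)
  case (Assm \<phi> \<Gamma>)
  then show ?case
    unfolding eventually_finite_subsets_at_top
    by (intro exI[of _ "{\<phi>}"]) (auto intro: deriv.Assm)
next
  case (Classical \<phi> \<Gamma>)
  from eventually_finite_subsets_insert[OF Classical.IH] show ?case
    by eventually_elim (rule deriv.Classical[OF _ Classical.hyps(2)])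
next
  case (DisjE \<Gamma> \<phi> \<psi> \<chi>)
  from DisjE.IH(1) DisjE.IH(2,3)[THEN eventually_finite_subsets_insert] show ?case
    by eventually_elim (rule deriv.DisjE)
next
  case (ImplI \<phi> \<Gamma> \<psi>)
  from eventually_finite_subsets_insert[OF ImplI.IH] show ?case
    by eventually_elim (rule deriv.ImplI[OF _ ImplI.hyps(2)])
next
  case (ForallI \<Gamma> \<phi>)
  from eventually_finite_subsets_image[OF ForallI.IH] show ?case
    by eventually_elim (rule deriv.ForallI)
next
  case (ExistsE \<Gamma> \<phi> \<chi>)
  from ExistsE.IH(1)
    eventually_finite_subsets_image[OF eventually_finite_subsets_insert[OF ExistsE.IH(2)]]
  show ?case by eventually_elim (rule deriv.ExistsE[OF _ _ ExistsE.hyps(3)])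
next
  case (ConjI \<Gamma> \<phi> \<psi>)
  from ConjI.IH show ?case by eventually_elim (rule deriv.ConjI)
next
  case (ImplE \<Gamma> \<phi> \<psi>)
  from ImplE.IH show ?case by eventually_elim (rule deriv.ImplE)
next
  case (EqualE \<Gamma> t u \<phi>)
  from EqualE.IH show ?case by eventually_elim (rule deriv.EqualE[OF _ _ EqualE.hyps(3)])
next
  case (EqualI t \<Gamma>)
  then show ?case by (simp add: deriv.EqualI)
qed (erule eventually_mono, erule deriv.ConjE1 deriv.ConjE2 deriv.DisjI1 deriv.DisjI2
    deriv.ForallE deriv.ExistsI; assumption)+

lemma consistent_Union_chain:
  fixes \<Gamma> :: "nat \<Rightarrow> fm set"
  assumes "mono \<Gamma>" and "\<And>n. consistent F (\<Gamma> n)"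
  shows "consistent F (\<Union>n. \<Gamma> n)"
  unfolding consistent_def
proof
  assume "deriv F (\<Union>n. \<Gamma> n) Falsum"
  from eventually_deriv_finite_subsets[OF this]
  obtain \<Delta> where \<Delta>: "finite \<Delta>" "\<Delta> \<subseteq> (\<Union>n. \<Gamma> n)" "deriv F \<Delta> Falsum"
    unfolding eventually_finite_subsets_at_top by force
  have "\<Gamma> m \<subseteq> \<Gamma> n \<or> \<Gamma> n \<subseteq> \<Gamma> m" for m n
    using monoD[OF assms(1)] by (meson nat_le_linear)
  then have "subset.chain UNIV (range \<Gamma>)" by (auto simp: subset_chain_def)
  then obtain n where "\<Delta> \<subseteq> \<Gamma> n"
    using finite_subset_Union_chain[OF \<Delta>(1,2)] by (metis UNIV_not_empty image_iff image_is_empty)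
  then have "deriv F (\<Gamma> n) Falsum" by (rule deriv_weaken[OF \<Delta>(3)])
  with assms(2) show False by (simp add: consistent_def)
qed


section \<open>Structures and soundness\<close>

record 'a struct =
  zero :: 'a ("\<zero>\<index>")
  succ :: "'a \<Rightarrow> 'a" ("\<S>\<index>")
  add :: "'a \<Rightarrow> 'a \<Rightarrow> 'a" (infixl "\<oplus>\<index>" 65)
  mult :: "'a \<Rightarrow> 'a \<Rightarrow> 'a" (infixl "\<otimes>\<index>" 70)
  func :: "pfun \<Rightarrow> 'a list \<Rightarrow> 'a"

fun val :: "'a struct \<Rightarrow> (nat \<Rightarrow> 'a) \<Rightarrow> tm \<Rightarrow> 'a" where
  "val M e (Var i) = e i"
| "val M e Zero = \<zero>\<^bsub>M\<^esub>"
| "val M e (Succ t) = \<S>\<^bsub>M\<^esub> (val M e t)"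
| "val M e (Add t u) = val M e t \<oplus>\<^bsub>M\<^esub> val M e u"
| "val M e (Mul t u) = val M e t \<otimes>\<^bsub>M\<^esub> val M e u"
| "val M e (Fn f ts) = func M f (map (val M e) ts)"

fun sat :: "'a struct \<Rightarrow> (nat \<Rightarrow> 'a) \<Rightarrow> fm \<Rightarrow> bool" where
  "sat M e (Equal t u) \<longleftrightarrow> val M e t = val M e u"
| "sat M e Falsum \<longleftrightarrow> False"
| "sat M e (Conj \<phi> \<psi>) \<longleftrightarrow> sat M e \<phi> \<and> sat M e \<psi>"
| "sat M e (Disj \<phi> \<psi>) \<longleftrightarrow> sat M e \<phi> \<or> sat M e \<psi>"
| "sat M e (Impl \<phi> \<psi>) \<longleftrightarrow> (sat M e \<phi> \<longrightarrow> sat M e \<psi>)"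
| "sat M e (Forall \<phi>) \<longleftrightarrow> (\<forall>a. sat M (case_nat a e) \<phi>)"
| "sat M e (Exists \<phi>) \<longleftrightarrow> (\<exists>a. sat M (case_nat a e) \<phi>)"

definition models :: "'a struct \<Rightarrow> fm set \<Rightarrow> bool" where
  "models M \<Gamma> \<longleftrightarrow> (\<forall>\<phi>\<in>\<Gamma>. \<forall>e. sat M e \<phi>)"

lemma case_nat_0_Suc [simp]: "case_nat (e 0) (\<lambda>i. e (Suc i)) = e"
  by (rule ext) (simp split: nat.split)

lemma val_cong: "(\<And>i. i \<in> fv_tm t \<Longrightarrow> e i = e' i) \<Longrightarrow> val M e t = val M e' t"
proof (induction t)
  case (Fn f ts)
  then have "map (val M e) ts = map (val M e') ts" by auto
  then show ?case by (simp del: map_eq_conv)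
qed auto

lemma sat_cong: "(\<And>i. i \<in> fv \<phi> \<Longrightarrow> e i = e' i) \<Longrightarrow> sat M e \<phi> = sat M e' \<phi>"
proof (induction \<phi> arbitrary: e e')
  case (Equal t u)
  then show ?case using val_cong[of t e e'] val_cong[of u e e'] by auto
next
  case (Forall \<phi>)
  have "sat M (case_nat a e) \<phi> = sat M (case_nat a e') \<phi>" for a
    by (rule Forall.IH) (auto simp: Forall.prems split: nat.split)
  then show ?case by simp
next
  case (Exists \<phi>)
  have "sat M (case_nat a e) \<phi> = sat M (case_nat a e') \<phi>" for a
    by (rule Exists.IH) (auto simp: Exists.prems split: nat.split)
  then show ?case by simp
qed (metis UnCI fv.simps(2-5) sat.simps(2-5))+

lemma val_case_nat:
  "(\<lambda>i. val M e (case_nat t \<sigma> i)) = case_nat (val M e t) (\<lambda>i. val M e (\<sigma> i))"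
  by (rule ext) (simp split: nat.split)

lemma val_subst: "val M e (subst_tm \<sigma> t) = val M (\<lambda>i. val M e (\<sigma> i)) t"
  by (induction t) (auto intro!: arg_cong[where f = "func M _"])

lemma val_lift [simp]: "val M e (lift_tm t) = val M (\<lambda>i. e (Suc i)) t"
  by (simp add: lift_tm_def val_subst)

lemma val_up: "(\<lambda>i. val M (case_nat a e) (up \<sigma> i)) = case_nat a (\<lambda>i. val M e (\<sigma> i))"
  by (simp add: up_def val_case_nat)

lemma sat_subst: "sat M e (subst \<sigma> \<phi>) = sat M (\<lambda>i. val M e (\<sigma> i)) \<phi>"
  by (induction \<phi> arbitrary: e \<sigma>) (simp_all add: val_subst val_up)

lemma sat_lift [simp]: "sat M e (lift \<phi>) = sat M (\<lambda>i. e (Suc i)) \<phi>"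
  by (simp add: lift_def sat_subst)

lemma sat_inst [simp]: "sat M e (inst \<phi> t) = sat M (case_nat (val M e t) e) \<phi>"
  by (simp add: inst_def sat_subst val_case_nat)

lemma soundness: "deriv F \<Gamma> \<phi> \<Longrightarrow> (\<And>\<gamma>. \<gamma> \<in> \<Gamma> \<Longrightarrow> sat M e \<gamma>) \<Longrightarrow> sat M e \<phi>"
proof (induction arbitrary: e rule: deriv.induct)
  case (Classical \<phi> \<Gamma>)
  then show ?case by fastforce
next
  case (DisjE \<Gamma> \<phi> \<psi> \<chi>)
  then have "sat M e (Disj \<phi> \<psi>)" by blast
  then show ?case using DisjE by auto
next
  case (ForallI \<Gamma> \<phi>)
  have "sat M (case_nat a e) \<phi>" for a using ForallI.prems by (intro ForallI.IH) auto
  then show ?case by simp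
next
  case (ExistsE \<Gamma> \<phi> \<chi>)
  have "sat M e (Exists \<phi>)" using ExistsE.IH(1) ExistsE.prems by blast
  then obtain a where "sat M (case_nat a e) \<phi>" by auto
  then have "sat M (case_nat a e) (lift \<chi>)" using ExistsE.prems by (intro ExistsE.IH(2)) auto
  then show ?case by simp
next
  case (EqualE \<Gamma> t u \<phi>)
  then show ?case by simp
qed auto

lemma models_deriv: "models M \<Gamma> \<Longrightarrow> deriv F \<Gamma> \<phi> \<Longrightarrow> sat M e \<phi>"
  by (auto simp: models_def intro: soundness)

lemma all_sat_Forall: "(\<forall>e. sat M e (Forall \<phi>)) \<longleftrightarrow> (\<forall>e. sat M e \<phi>)"
  unfolding sat.simps by (metis case_nat_0_Suc)

lemma all_sat_alls: "(\<forall>e. sat M e (alls n \<phi>)) \<longleftrightarrow> (\<forall>e. sat M e \<phi>)"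
  unfolding alls_def by (induction n) (simp_all add: all_sat_Forall del: sat.simps)


section \<open>Henkin theories and completeness\<close>

instance pfun :: countable by countable_datatype
instance tm :: countable by countable_datatype
instance fm :: countable by countable_datatype

locale henkin_theory =
  fixes F :: "pfun set" and \<Gamma> :: "fm set"
  assumes consistent: "consistent F \<Gamma>"
    and wf: "\<phi> \<in> \<Gamma> \<Longrightarrow> wf_fm F \<phi>"
    and maximal: "wf_fm F \<phi> \<Longrightarrow> consistent F (insert \<phi> \<Gamma>) \<Longrightarrow> \<phi> \<in> \<Gamma>"
    and witness: "Exists \<phi> \<in> \<Gamma> \<Longrightarrow> \<exists>t. wf_tm F t \<and> inst \<phi> t \<in> \<Gamma>"

lemma consistent_insert_witness:
  assumes "consistent F \<Gamma>" and ex: "Exists \<phi> \<in> \<Gamma>" "wf_fm F \<phi>"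
    and fresh: "\<And>\<gamma>. \<gamma> \<in> \<Gamma> \<Longrightarrow> m \<notin> fv \<gamma>"
  shows "consistent F (insert (inst \<phi> (Var m)) \<Gamma>)"
  unfolding consistent_def
proof
  assume "deriv F (insert (inst \<phi> (Var m)) \<Gamma>) Falsum"
  define \<sigma> where "\<sigma> i = (if i = m then Var 0 else Var (Suc i))" for i
  have "subst \<sigma> (inst \<phi> (Var m)) = subst Var \<phi>"
    unfolding inst_def subst_subst
    using fresh[OF ex(1)] by (intro subst_cong) (auto simp: \<sigma>_def split: nat.split)
  moreover have "subst \<sigma> \<gamma> = lift \<gamma>" if "\<gamma> \<in> \<Gamma>" for \<gamma>
    unfolding lift_def using fresh[OF that] by (intro subst_cong) (auto simp: \<sigma>_def)
  ultimately have "subst \<sigma> ` insert (inst \<phi> (Var m)) \<Gamma> \<subseteq> insert \<phi> (lift ` \<Gamma>)" by auto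
  then have "deriv F (insert \<phi> (lift ` \<Gamma>)) (subst \<sigma> Falsum)"
    by (rule deriv_subst[OF \<open>deriv F _ Falsum\<close>, rotated]) (simp add: \<sigma>_def)
  then have "deriv F (insert \<phi> (lift ` \<Gamma>)) (lift Falsum)" by (simp add: lift_def)
  moreover have "deriv F \<Gamma> (Exists \<phi>)" using ex by (intro deriv.Assm) simp_all
  ultimately have "deriv F \<Gamma> Falsum" by (intro deriv.ExistsE[of F \<Gamma> \<phi> Falsum]) simp_all
  with \<open>consistent F \<Gamma>\<close> show False by (simp add: consistent_def)
qed

definition extendable :: "pfun set \<Rightarrow> fm set \<Rightarrow> bool" where
  "extendable F \<Gamma> \<longleftrightarrow> consistent F \<Gamma> \<and> (\<forall>\<phi>\<in>\<Gamma>. wf_fm F \<phi>) \<and> finite (\<Union>\<phi>\<in>\<Gamma>. fv \<phi>)"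

definition settles :: "pfun set \<Rightarrow> fm set \<Rightarrow> fm \<Rightarrow> bool" where
  "settles F \<Gamma> \<phi> \<longleftrightarrow> (wf_fm F \<phi> \<and> consistent F (insert \<phi> \<Gamma>) \<longrightarrow> \<phi> \<in> \<Gamma> \<and>
     (\<forall>\<psi>. \<phi> = Exists \<psi> \<longrightarrow> (\<exists>t. wf_tm F t \<and> inst \<psi> t \<in> \<Gamma>)))"

lemma extendable_settles:
  assumes "extendable F \<Gamma>"
  obtains \<Delta> where "extendable F \<Delta>" "\<Gamma> \<subseteq> \<Delta>" "settles F \<Delta> \<phi>"
proof (cases "wf_fm F \<phi> \<and> consistent F (insert \<phi> \<Gamma>)")
  case False
  with assms that show ?thesis by (auto simp: settles_def)
next
  case True
  let ?\<Delta> = "insert \<phi> \<Gamma>"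
  have ext: "extendable F ?\<Delta>" using assms True by (simp add: extendable_def)
  show ?thesis
  proof (cases "\<exists>\<psi>. \<phi> = Exists \<psi>")
    case False
    with ext that show ?thesis by (auto simp: settles_def)
  next
    case True
    then obtain \<psi> where \<psi>: "\<phi> = Exists \<psi>" by blast
    obtain m where "m \<notin> (\<Union>\<gamma>\<in>?\<Delta>. fv \<gamma>)"
      using ext ex_new_if_finite[OF infinite_UNIV_nat] unfolding extendable_def by blast
    then have "consistent F (insert (inst \<psi> (Var m)) ?\<Delta>)"
      using ext \<psi> by (intro consistent_insert_witness) (auto simp: extendable_def)
    then have "extendable F (insert (inst \<psi> (Var m)) ?\<Delta>)"
      using ext \<psi> by (simp add: extendable_def)
    then show ?thesis
      by (rule that) (use \<psi> in \<open>auto simp: settles_def intro: exI[of _ "Var m"]\<close>)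
  qed
qed

lemma henkin_extension:
  assumes "extendable F \<Gamma>"
  obtains \<Delta> where "\<Gamma> \<subseteq> \<Delta>" "henkin_theory F \<Delta>"
proof -
  have "\<exists>H. \<forall>n. (extendable F (H n) \<and> \<Gamma> \<subseteq> H n) \<and>
      (H n \<subseteq> H (Suc n) \<and> settles F (H (Suc n)) (from_nat n))"
    by (rule dependent_nat_choice)
      (use assms in blast, metis extendable_settles subset_trans)
  then obtain H where chain: "extendable F (H n)" "\<Gamma> \<subseteq> H n" "H n \<subseteq> H (Suc n)"
    "settles F (H (Suc n)) (from_nat n)" for n by blast
  define \<Delta> where "\<Delta> = (\<Union>n. H n)"
  have "consistent F \<Delta>"
    unfolding \<Delta>_def
    using chain by (intro consistent_Union_chain) (simp_all add: mono_iff_le_Suc extendable_def)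
  have wf: "wf_fm F \<phi>" if "\<phi> \<in> \<Delta>" for \<phi>
    using that chain(1) by (auto simp: \<Delta>_def extendable_def)
  have settled: "\<phi> \<in> \<Delta> \<and> (\<forall>\<psi>. \<phi> = Exists \<psi> \<longrightarrow> (\<exists>t. wf_tm F t \<and> inst \<psi> t \<in> \<Delta>))"
    if "wf_fm F \<phi>" "consistent F (insert \<phi> \<Delta>)" for \<phi>
  proof -
    let ?H = "H (Suc (to_nat \<phi>))"
    have "?H \<subseteq> \<Delta>" by (auto simp: \<Delta>_def)
    moreover have "consistent F (insert \<phi> ?H)"
      using that(2) \<open>?H \<subseteq> \<Delta>\<close> by (auto intro: consistent_subset)
    ultimately show ?thesis
      using chain(4)[of "to_nat \<phi>"] that(1) unfolding settles_def from_nat_to_nat by blast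
  qed
  have "henkin_theory F \<Delta>"
  proof
    fix \<psi> assume "Exists \<psi> \<in> \<Delta>"
    then show "\<exists>t. wf_tm F t \<and> inst \<psi> t \<in> \<Delta>"
      using settled[of "Exists \<psi>"] wf[of "Exists \<psi>"] \<open>consistent F \<Delta>\<close>
      by (simp add: insert_absorb)
  qed (use \<open>consistent F \<Delta>\<close> wf settled in auto)
  moreover have "\<Gamma> \<subseteq> \<Delta>" using chain(2) by (auto simp: \<Delta>_def)
  ultimately show ?thesis using that by blast
qed

context henkin_theory
begin

lemma mem_iff_deriv: "\<phi> \<in> \<Gamma> \<longleftrightarrow> deriv F \<Gamma> \<phi>"
proof
  assume "\<phi> \<in> \<Gamma>"
  then show "deriv F \<Gamma> \<phi>" by (simp add: deriv.Assm wf)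
next
  assume \<phi>: "deriv F \<Gamma> \<phi>"
  have "consistent F (insert \<phi> \<Gamma>)"
    unfolding consistent_def
  proof
    assume "deriv F (insert \<phi> \<Gamma>) Falsum"
    then have "deriv F \<Gamma> Falsum" using \<phi> deriv_imp_wf deriv.ImplI deriv.ImplE by blast
    with consistent show False by (simp add: consistent_def)
  qed
  with deriv_imp_wf[OF \<phi>] show "\<phi> \<in> \<Gamma>" by (rule maximal)
qed

lemma Falsum_notin: "Falsum \<notin> \<Gamma>"
  using consistent by (simp add: consistent_def mem_iff_deriv)

lemma deriv_insert_Falsum: "wf_fm F \<phi> \<Longrightarrow> \<phi> \<notin> \<Gamma> \<Longrightarrow> deriv F (insert \<phi> \<Gamma>) Falsum"
  using maximal by (auto simp: consistent_def)

lemma Neg_iff: "wf_fm F \<phi> \<Longrightarrow> Neg \<phi> \<in> \<Gamma> \<longleftrightarrow> \<phi> \<notin> \<Gamma>"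
  using deriv_insert_Falsum Falsum_notin deriv.ImplI deriv.ImplE unfolding mem_iff_deriv by blast

lemma Conj_iff: "Conj \<phi> \<psi> \<in> \<Gamma> \<longleftrightarrow> \<phi> \<in> \<Gamma> \<and> \<psi> \<in> \<Gamma>"
  using deriv.ConjI deriv.ConjE1 deriv.ConjE2 unfolding mem_iff_deriv by blast

lemma Disj_iff:
  assumes "wf_fm F \<phi>" "wf_fm F \<psi>"
  shows "Disj \<phi> \<psi> \<in> \<Gamma> \<longleftrightarrow> \<phi> \<in> \<Gamma> \<or> \<psi> \<in> \<Gamma>"
proof
  assume "Disj \<phi> \<psi> \<in> \<Gamma>"
  then show "\<phi> \<in> \<Gamma> \<or> \<psi> \<in> \<Gamma>"
    using deriv_insert_Falsum[OF assms(1)] deriv_insert_Falsum[OF assms(2)] Falsum_notin deriv.DisjE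
    unfolding mem_iff_deriv by blast
next
  assume "\<phi> \<in> \<Gamma> \<or> \<psi> \<in> \<Gamma>"
  then show "Disj \<phi> \<psi> \<in> \<Gamma>"
    using assms deriv.DisjI1 deriv.DisjI2 unfolding mem_iff_deriv by blast
qed

lemma Impl_iff:
  assumes "wf_fm F \<phi>" "wf_fm F \<psi>"
  shows "Impl \<phi> \<psi> \<in> \<Gamma> \<longleftrightarrow> (\<phi> \<in> \<Gamma> \<longrightarrow> \<psi> \<in> \<Gamma>)"
proof
  assume "Impl \<phi> \<psi> \<in> \<Gamma>"
  then show "\<phi> \<in> \<Gamma> \<longrightarrow> \<psi> \<in> \<Gamma>" using deriv.ImplE unfolding mem_iff_deriv by blast
next
  assume "\<phi> \<in> \<Gamma> \<longrightarrow> \<psi> \<in> \<Gamma>"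
  then consider (antecedent_false) "\<phi> \<notin> \<Gamma>" | (consequent_true) "\<psi> \<in> \<Gamma>" by blast
  then have "deriv F (insert \<phi> \<Gamma>) \<psi>"
  proof cases
    case antecedent_false
    then have "deriv F (insert (Neg \<psi>) (insert \<phi> \<Gamma>)) Falsum"
      using deriv_insert_Falsum[OF assms(1)] by (auto intro: deriv_weaken)
    then show ?thesis using assms(2) by (rule deriv.Classical)
  next
    case consequent_true
    with assms(2) show ?thesis by (intro deriv.Assm) simp_all
  qed
  then show "Impl \<phi> \<psi> \<in> \<Gamma>" using assms(1) by (simp add: mem_iff_deriv deriv.ImplI)
qed

lemma Exists_iff:
  assumes "wf_fm F \<phi>"
  shows "Exists \<phi> \<in> \<Gamma> \<longleftrightarrow> (\<exists>t. wf_tm F t \<and> inst \<phi> t \<in> \<Gamma>)"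
  using witness deriv.ExistsI[OF _ _ assms] unfolding mem_iff_deriv by blast

lemma Forall_iff:
  assumes "wf_fm F \<phi>"
  shows "Forall \<phi> \<in> \<Gamma> \<longleftrightarrow> (\<forall>t. wf_tm F t \<longrightarrow> inst \<phi> t \<in> \<Gamma>)"
proof
  assume "Forall \<phi> \<in> \<Gamma>"
  then show "\<forall>t. wf_tm F t \<longrightarrow> inst \<phi> t \<in> \<Gamma>" using deriv.ForallE unfolding mem_iff_deriv by blast
next
  assume instances: "\<forall>t. wf_tm F t \<longrightarrow> inst \<phi> t \<in> \<Gamma>"
  let ?\<nu> = "Exists (Neg \<phi>)" and ?\<Delta> = "insert (Neg \<phi>) (lift ` \<Gamma>)"
  have "?\<nu> \<notin> \<Gamma>" using instances assms by (simp add: Exists_iff Neg_iff)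
  then have "Neg ?\<nu> \<in> \<Gamma>" using assms by (simp add: Neg_iff)
  then have "lift (Neg ?\<nu>) \<in> ?\<Delta>" by blast
  then have "deriv F ?\<Delta> (lift (Neg ?\<nu>))" using assms by (intro deriv.Assm) simp_all
  moreover have "deriv F ?\<Delta> (lift ?\<nu>)"
  proof -
    let ?\<psi> = "subst (up (\<lambda>i. Var (Suc i))) (Neg \<phi>)"
    have "case_nat (Var 0) (\<lambda>i. Var (Suc i)) = Var" by (rule case_nat_0_Suc)
    then have "inst ?\<psi> (Var 0) = Neg \<phi>" unfolding inst_subst_up by simp
    moreover have "deriv F ?\<Delta> (Neg \<phi>)" using assms by (intro deriv.Assm) simp_all
    ultimately have "deriv F ?\<Delta> (Exists ?\<psi>)"
      using assms by (intro deriv.ExistsI[of _ _ _ "Var 0"]) simp_all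
    then show ?thesis by (simp add: lift_def)
  qed
  ultimately have "deriv F ?\<Delta> Falsum" unfolding lift_def subst.simps by (rule deriv.ImplE)
  then have "deriv F (lift ` \<Gamma>) \<phi>" using assms by (rule deriv.Classical)
  then show "Forall \<phi> \<in> \<Gamma>" by (simp add: mem_iff_deriv deriv.ForallI)
qed

lemma Equal_refl: "wf_tm F t \<Longrightarrow> Equal t t \<in> \<Gamma>"
  by (simp add: mem_iff_deriv deriv.EqualI)

lemma Equal_subst: "Equal t u \<in> \<Gamma> \<Longrightarrow> inst \<phi> t \<in> \<Gamma> \<Longrightarrow> wf_fm F \<phi> \<Longrightarrow> inst \<phi> u \<in> \<Gamma>"
  unfolding mem_iff_deriv by (rule deriv.EqualE)

lemma Equal_sym: "Equal t u \<in> \<Gamma> \<Longrightarrow> Equal u t \<in> \<Gamma>"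
  using Equal_subst[of t u "Equal (Var 0) (lift_tm t)"] Equal_refl[of t] wf[of "Equal t u"] by simp

lemma Equal_trans: "Equal t u \<in> \<Gamma> \<Longrightarrow> Equal u v \<in> \<Gamma> \<Longrightarrow> Equal t v \<in> \<Gamma>"
  using Equal_subst[of u v "Equal (lift_tm t) (Var 0)"] wf[of "Equal t u"] by simp

lemma Equal_subst_tm_upd:
  assumes "Equal u u' \<in> \<Gamma>" "wf_tm F t" "\<And>j. wf_tm F (\<sigma> j)"
  shows "Equal (subst_tm (\<sigma>(i := u)) t) (subst_tm (\<sigma>(i := u')) t) \<in> \<Gamma>"
proof -
  let ?t = "subst_tm (\<sigma>(i := u)) t" and ?C = "subst_tm ((\<lambda>j. lift_tm (\<sigma> j))(i := Var 0)) t"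
  have plug: "subst_tm (case_nat v Var) ?C = subst_tm (\<sigma>(i := v)) t" for v
    unfolding subst_tm_subst_tm by (rule subst_tm_cong) simp
  have "wf_tm F ?t" using assms wf[OF assms(1)] by simp
  then show ?thesis
    using assms Equal_subst[OF assms(1), of "Equal (lift_tm ?t) ?C"] Equal_refl[of ?t]
    by (simp add: plug)
qed

lemma Equal_subst_tm:
  assumes t: "wf_tm F t" and eq: "\<And>i. Equal (\<sigma> i) (\<tau> i) \<in> \<Gamma>"
  shows "Equal (subst_tm \<sigma> t) (subst_tm \<tau> t) \<in> \<Gamma>"
proof -
  have wf_\<sigma>\<tau>: "wf_tm F (\<sigma> i)" "wf_tm F (\<tau> i)" for i using wf[OF eq[of i]] by simp_all
  have "Equal (subst_tm \<sigma> t) (subst_tm (override_on \<sigma> \<tau> A) t) \<in> \<Gamma>" if "finite A" for A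
    using that
  proof induction
    case empty
    show ?case using t wf_\<sigma>\<tau> by (simp add: Equal_refl)
  next
    case (insert i A)
    let ?\<rho> = "override_on \<sigma> \<tau> A"
    have "wf_tm F (?\<rho> j)" for j using wf_\<sigma>\<tau> by (simp add: override_on_def)
    then have "Equal (subst_tm (?\<rho>(i := \<sigma> i)) t) (subst_tm (?\<rho>(i := \<tau> i)) t) \<in> \<Gamma>"
      by (rule Equal_subst_tm_upd[OF eq t])
    moreover have "?\<rho>(i := \<sigma> i) = ?\<rho>" using insert by (simp add: fun_upd_idem)
    ultimately have "Equal (subst_tm ?\<rho> t) (subst_tm (override_on \<sigma> \<tau> (insert i A)) t) \<in> \<Gamma>"
      by (simp add: override_on_insert)
    with insert.IH show ?case by (rule Equal_trans)
  qed
  from this[of "fv_tm t"] show ?thesis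
    using subst_tm_cong[of t "override_on \<sigma> \<tau> (fv_tm t)" \<tau>] by simp
qed

end

locale term_model = henkin_theory F \<Gamma> for F \<Gamma> +
  fixes cls :: "tm \<Rightarrow> 'a"
  assumes cls_eq_iff: "wf_tm F t \<Longrightarrow> wf_tm F u \<Longrightarrow> cls t = cls u \<longleftrightarrow> Equal t u \<in> \<Gamma>"
    and cls_surj: "\<exists>t. wf_tm F t \<and> cls t = a"
begin

definition rep :: "'a \<Rightarrow> tm" where
  "rep a = (SOME t. wf_tm F t \<and> cls t = a)"

definition model :: "'a struct" where
  "model = \<lparr>zero = cls Zero, succ = (\<lambda>a. cls (Succ (rep a))),
     add = (\<lambda>a b. cls (Add (rep a) (rep b))), mult = (\<lambda>a b. cls (Mul (rep a) (rep b))),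
     func = (\<lambda>f as. cls (Fn f (map rep as)))\<rparr>"

lemma wf_rep [simp]: "wf_tm F (rep a)" and cls_rep [simp]: "cls (rep a) = a"
  using someI_ex[OF cls_surj[of a]] unfolding rep_def by simp_all

lemma cls_subst_tm:
  assumes "wf_tm F t" "\<And>i. wf_tm F (\<sigma> i)" "\<And>i. wf_tm F (\<tau> i)" "\<And>i. cls (\<sigma> i) = cls (\<tau> i)"
  shows "cls (subst_tm \<sigma> t) = cls (subst_tm \<tau> t)"
proof -
  have "Equal (\<sigma> i) (\<tau> i) \<in> \<Gamma>" for i using assms(2-4) by (simp flip: cls_eq_iff)
  with assms(1) have "Equal (subst_tm \<sigma> t) (subst_tm \<tau> t) \<in> \<Gamma>" by (rule Equal_subst_tm)
  with assms(1-3) show ?thesis by (simp add: cls_eq_iff)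
qed

lemma succ_cls: "wf_tm F t \<Longrightarrow> \<S>\<^bsub>model\<^esub> (cls t) = cls (Succ t)"
  using cls_subst_tm[of "Succ (Var 0)" "\<lambda>_. rep (cls t)" "\<lambda>_. t"] by (simp add: model_def)

lemma add_cls: "wf_tm F t \<Longrightarrow> wf_tm F u \<Longrightarrow> cls t \<oplus>\<^bsub>model\<^esub> cls u = cls (Add t u)"
  using cls_subst_tm[of "Add (Var 0) (Var 1)" "case_nat (rep (cls t)) (\<lambda>_. rep (cls u))"
      "case_nat t (\<lambda>_. u)"]
  by (simp add: model_def split: nat.split)

lemma mult_cls: "wf_tm F t \<Longrightarrow> wf_tm F u \<Longrightarrow> cls t \<otimes>\<^bsub>model\<^esub> cls u = cls (Mul t u)"
  using cls_subst_tm[of "Mul (Var 0) (Var 1)" "case_nat (rep (cls t)) (\<lambda>_. rep (cls u))"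
      "case_nat t (\<lambda>_. u)"]
  by (simp add: model_def split: nat.split)

lemma func_cls:
  assumes "wf_tm F (Fn f ts)"
  shows "func model f (map cls ts) = cls (Fn f ts)"
proof -
  let ?us = "map (\<lambda>t. rep (cls t)) ts" and ?t = "Fn f (map Var [0..<length ts])"
  have "cls (subst_tm (args ?us) ?t) = cls (subst_tm (args ts) ?t)"
    using assms by (intro cls_subst_tm) (simp_all add: args_def)
  then have "cls (Fn f ?us) = cls (Fn f ts)" by (simp only: subst_tm_args length_map)
  then show ?thesis by (simp add: model_def comp_def)
qed

lemma val_model:
  "wf_tm F t \<Longrightarrow> (\<And>i. wf_tm F (\<sigma> i)) \<Longrightarrow> val model (\<lambda>i. cls (\<sigma> i)) t = cls (subst_tm \<sigma> t)"
proof (induction t)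
  case Zero
  show ?case by (simp add: model_def)
next
  case (Fn f ts)
  then have "map (val model (\<lambda>i. cls (\<sigma> i))) ts = map cls (map (subst_tm \<sigma>) ts)" by simp
  then show ?case
    using Fn.prems func_cls[of f "map (subst_tm \<sigma>) ts"] by (simp del: map_map map_eq_conv)
qed (simp_all add: succ_cls add_cls mult_cls)

lemma sat_model_case_nat:
  assumes "\<And>\<sigma>. (\<And>i. wf_tm F (\<sigma> i)) \<Longrightarrow> sat model (\<lambda>i. cls (\<sigma> i)) \<phi> \<longleftrightarrow> subst \<sigma> \<phi> \<in> \<Gamma>"
    and "\<And>i. wf_tm F (\<sigma> i)" "wf_tm F t"
  shows "sat model (case_nat (cls t) (\<lambda>i. cls (\<sigma> i))) \<phi> \<longleftrightarrow> inst (subst (up \<sigma>) \<phi>) t \<in> \<Gamma>"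
  using assms(1)[of "case_nat t \<sigma>"] assms(2,3)
  by (simp add: inst_subst_up nat.case_distrib[of cls])

lemma sat_model:
  "wf_fm F \<phi> \<Longrightarrow> (\<And>i. wf_tm F (\<sigma> i)) \<Longrightarrow> sat model (\<lambda>i. cls (\<sigma> i)) \<phi> \<longleftrightarrow> subst \<sigma> \<phi> \<in> \<Gamma>"
proof (induction \<phi> arbitrary: \<sigma>)
  case (Forall \<phi>)
  then have "sat model (case_nat (cls t) (\<lambda>i. cls (\<sigma> i))) \<phi> \<longleftrightarrow> inst (subst (up \<sigma>) \<phi>) t \<in> \<Gamma>"
    if "wf_tm F t" for t
    using that by (intro sat_model_case_nat) simp_all
  then have "sat model (\<lambda>i. cls (\<sigma> i)) (Forall \<phi>) \<longleftrightarrow>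
      (\<forall>t. wf_tm F t \<longrightarrow> inst (subst (up \<sigma>) \<phi>) t \<in> \<Gamma>)"
    using cls_surj unfolding sat.simps by metis
  then show ?case using Forall.prems by (simp add: Forall_iff del: sat.simps)
next
  case (Exists \<phi>)
  then have "sat model (case_nat (cls t) (\<lambda>i. cls (\<sigma> i))) \<phi> \<longleftrightarrow> inst (subst (up \<sigma>) \<phi>) t \<in> \<Gamma>"
    if "wf_tm F t" for t
    using that by (intro sat_model_case_nat) simp_all
  then have "sat model (\<lambda>i. cls (\<sigma> i)) (Exists \<phi>) \<longleftrightarrow>
      (\<exists>t. wf_tm F t \<and> inst (subst (up \<sigma>) \<phi>) t \<in> \<Gamma>)"
    using cls_surj unfolding sat.simps by metis
  then show ?case using Exists.prems by (simp add: Exists_iff del: sat.simps)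
qed (simp_all add: val_model cls_eq_iff Falsum_notin Conj_iff Disj_iff Impl_iff)

lemma models_model:
  assumes "S \<subseteq> \<Gamma>" "is_theory F S"
  shows "models model S"
  unfolding models_def
proof (intro ballI allI)
  fix \<phi> e assume "\<phi> \<in> S"
  then have "wf_fm F \<phi>" "fv \<phi> = {}" "\<phi> \<in> \<Gamma>" using assms by (auto simp: is_theory_def)
  then show "sat model e \<phi>" using sat_model[of \<phi> "\<lambda>i. rep (e i)"] by (simp add: subst_sentence)
qed

end

context henkin_theory
begin

lemma term_model_nat:
  assumes distinct: "\<And>m n. Equal (numeral_tm m) (numeral_tm n) \<in> \<Gamma> \<Longrightarrow> m = n"
  obtains cls :: "tm \<Rightarrow> nat" where "term_model F \<Gamma> cls"
proof -
  define eq_class where "eq_class t = {u. Equal t u \<in> \<Gamma>}" for t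
  define Q where "Q = eq_class ` {t. wf_tm F t}"
  have eq_class_iff: "eq_class t = eq_class u \<longleftrightarrow> Equal t u \<in> \<Gamma>" if "wf_tm F t" "wf_tm F u" for t u
    using that Equal_refl Equal_sym Equal_trans unfolding eq_class_def by blast
  have "inj (\<lambda>n. eq_class (numeral_tm n))" by (rule injI) (simp add: eq_class_iff distinct)
  then have "infinite (range (\<lambda>n. eq_class (numeral_tm n)))" by (simp add: finite_image_iff)
  moreover have "range (\<lambda>n. eq_class (numeral_tm n)) \<subseteq> Q" by (auto simp: Q_def)
  ultimately have "infinite Q" using finite_subset by blast
  moreover have "countable Q" unfolding Q_def by (intro countable_image) simp
  ultimately have bij: "bij_betw (to_nat_on Q) Q UNIV" by (intro to_nat_on_infinite)
  have "term_model F \<Gamma> (\<lambda>t. to_nat_on Q (eq_class t))"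
  proof unfold_locales
    show "to_nat_on Q (eq_class t) = to_nat_on Q (eq_class u) \<longleftrightarrow> Equal t u \<in> \<Gamma>"
      if "wf_tm F t" "wf_tm F u" for t u
      using that bij eq_class_iff by (auto simp: Q_def bij_betw_def inj_on_eq_iff)
    show "\<exists>t. wf_tm F t \<and> to_nat_on Q (eq_class t) = n" for n
      using bij_betw_imp_surj_on[OF bij] unfolding Q_def
      by (metis (mono_tags) UNIV_I imageE mem_Collect_eq)
  qed
  then show ?thesis by (rule that)
qed

lemma PA_axiom_mem: "extends F \<Gamma> (PA F) \<Longrightarrow> \<phi> \<in> PA F \<Longrightarrow> wf_fm F \<phi> \<Longrightarrow> \<phi> \<in> \<Gamma>"
  by (simp add: extends_def mem_iff_deriv deriv.Assm)

lemma Succ_Zero_notin: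
  assumes "extends F \<Gamma> (PA F)" "wf_tm F t"
  shows "Equal (Succ t) Zero \<notin> \<Gamma>"
proof -
  have "Forall (Neg (Equal (Succ (Var 0)) Zero)) \<in> \<Gamma>"
    using assms(1) by (rule PA_axiom_mem) (simp_all add: PA_def alls_def)
  then show ?thesis using assms(2) by (simp add: Forall_iff Neg_iff)
qed

lemma Succ_inject:
  assumes "extends F \<Gamma> (PA F)" "wf_tm F t" "wf_tm F u" and eq: "Equal (Succ t) (Succ u) \<in> \<Gamma>"
  shows "Equal t u \<in> \<Gamma>"
proof -
  let ?\<phi> = "Impl (Equal (Succ (Var 0)) (Succ (Var 1))) (Equal (Var 0) (Var 1))"
  have "Forall (Forall ?\<phi>) \<in> \<Gamma>"
    using assms(1) by (rule PA_axiom_mem) (simp_all add: PA_def alls_def numeral_2_eq_2)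
  then have "inst (Forall ?\<phi>) u \<in> \<Gamma>" using assms(3) by (simp add: Forall_iff)
  then have "Forall (subst (up (case_nat u Var)) ?\<phi>) \<in> \<Gamma>" by (simp only: inst_def subst.simps)
  then have "inst (subst (up (case_nat u Var)) ?\<phi>) t \<in> \<Gamma>"
    using assms(2,3) by (subst (asm) Forall_iff) simp_all
  then show ?thesis using assms(2,3) eq by (simp add: Impl_iff)
qed

lemma numeral_tm_inject:
  assumes ext: "extends F \<Gamma> (PA F)"
  shows "Equal (numeral_tm m) (numeral_tm n) \<in> \<Gamma> \<Longrightarrow> m = n"
proof (induction m n rule: diff_induct)
  case (1 m)
  then show ?case using Succ_Zero_notin[OF ext] by (cases m) auto
next
  case (2 n)
  then show ?case using Succ_Zero_notin[OF ext, of "numeral_tm n"] Equal_sym by auto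
next
  case (3 m n)
  then show ?case using Succ_inject[OF ext, of "numeral_tm m" "numeral_tm n"] by simp
qed

end

text \<open>
  The carrier \<^typ>\<open>nat\<close> suffices because the language is countable and every model of PA is infinite.
\<close>

theorem completeness:
  assumes S: "is_theory F S" "extends F S (PA F)" and \<phi>: "wf_fm F \<phi>"
    and valid: "\<And>(M :: nat struct) e. models M S \<Longrightarrow> sat M e \<phi>"
  shows "deriv F S \<phi>"
proof (rule ccontr)
  assume "\<not> deriv F S \<phi>"
  then have "consistent F (insert (Neg \<phi>) S)"
    using \<phi> deriv.Classical by (auto simp: consistent_def)
  then have "extendable F (insert (Neg \<phi>) S)"
    using S(1) \<phi> by (auto simp: extendable_def is_theory_def)
  then obtain \<Delta> where \<Delta>: "insert (Neg \<phi>) S \<subseteq> \<Delta>" "henkin_theory F \<Delta>" by (rule henkin_extension)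
  then interpret henkin_theory F \<Delta> by simp
  have "extends F \<Delta> (PA F)" using S(2) \<Delta>(1) by (auto simp: extends_def intro: deriv_weaken)
  then obtain cls :: "tm \<Rightarrow> nat" where "term_model F \<Delta> cls"
    using term_model_nat numeral_tm_inject by blast
  then interpret term_model F \<Delta> cls .
  have "models model S" using \<Delta>(1) S(1) by (intro models_model) simp_all
  then have "sat model (\<lambda>i. cls (Var i)) \<phi>" by (rule valid)
  moreover have "sat model (\<lambda>i. cls (Var i)) (Neg \<phi>)"
    using sat_model[of "Neg \<phi>" Var] \<phi> \<Delta>(1) by simp
  ultimately show False by simp
qed


section \<open>Models of Peano arithmetic\<close>

lemma wf_leq [simp]: "wf_fm F (leq t u) \<longleftrightarrow> wf_tm F t \<and> wf_tm F u"
  and wf_lt [simp]: "wf_fm F (lt t u) \<longleftrightarrow> wf_tm F t \<and> wf_tm F u"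
  by (simp_all add: leq_def lt_def)

lemma subst_lt: "subst \<sigma> (lt t u) = lt (subst_tm \<sigma> t) (subst_tm \<sigma> u)"
  by (simp add: leq_def lt_def subst_tm_up_lift_tm)

lemma alls_inject [simp]: "alls n \<phi> = alls n \<psi> \<longleftrightarrow> \<phi> = \<psi>"
  unfolding alls_def by (induction n) simp_all

lemma arity_pair_pf [simp]: "arity pair_pf = 2"
  by (simp add: pair_pf_def)

lemma arity_const_pf [simp]: "arity (const_pf n k) = n"
  by (cases k) simp_all

lemma arity_num_pf [simp]: "arity num_pf = 1"
  by (simp add: num_pf_def)

lemma wf_defining_axioms:
  assumes "admissible F" "f \<in> F" "\<phi> \<in> defining_axioms f"
  shows "wf_fm F \<phi>"
proof -
  have "wf_pf f" "constituents f \<subseteq> F" using assms(1,2) by (auto simp: admissible_def)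
  then show ?thesis using assms(2,3) by (cases f) (auto simp: Let_def)
qed

lemma wf_PA: "admissible F \<Longrightarrow> \<phi> \<in> PA F \<Longrightarrow> wf_fm F \<phi>"
  by (auto simp: PA_def wf_defining_axioms induction_fm_def)

definition struct_le :: "'a struct \<Rightarrow> 'a \<Rightarrow> 'a \<Rightarrow> bool" (infix "\<preceq>\<index>" 50) where
  "a \<preceq>\<^bsub>M\<^esub> b \<longleftrightarrow> (\<exists>c. c \<oplus>\<^bsub>M\<^esub> a = b)"

definition struct_less :: "'a struct \<Rightarrow> 'a \<Rightarrow> 'a \<Rightarrow> bool" (infix "\<prec>\<index>" 50) where
  "a \<prec>\<^bsub>M\<^esub> b \<longleftrightarrow> \<S>\<^bsub>M\<^esub> a \<preceq>\<^bsub>M\<^esub> b"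

lemma sat_leq [simp]: "sat M e (leq t u) \<longleftrightarrow> val M e t \<preceq>\<^bsub>M\<^esub> val M e u"
  by (simp add: leq_def struct_le_def)

lemma sat_lt [simp]: "sat M e (lt t u) \<longleftrightarrow> val M e t \<prec>\<^bsub>M\<^esub> val M e u"
  by (simp add: lt_def struct_less_def)

primrec standard :: "'a struct \<Rightarrow> nat \<Rightarrow> 'a" where
  "standard M 0 = \<zero>\<^bsub>M\<^esub>"
| "standard M (Suc n) = \<S>\<^bsub>M\<^esub> (standard M n)"

lemma val_numeral_tm [simp]: "val M e (numeral_tm n) = standard M n"
  by (induction n) simp_all

locale pa_model =
  fixes F :: "pfun set" and M :: "'a struct" (structure)
  assumes admissible: "admissible F" and models_PA: "models M (PA F)"
begin

lemma sat_axiom: "alls n \<phi> \<in> PA F \<Longrightarrow> sat M e \<phi>"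
  using models_PA all_sat_alls unfolding models_def by blast

lemma succ_neq_zero [simp]: "\<S> a \<noteq> \<zero>" "\<zero> \<noteq> \<S> a"
  using sat_axiom[of 1 "Neg (Equal (Succ (Var 0)) Zero)" "\<lambda>_. a"] by (auto simp: PA_def)

lemma succ_inject [simp]: "\<S> a = \<S> b \<longleftrightarrow> a = b"
  using sat_axiom[of 2 "Impl (Equal (Succ (Var 0)) (Succ (Var 1))) (Equal (Var 0) (Var 1))"
      "case_nat a (\<lambda>_. b)"]
  by (auto simp: PA_def)

lemma add_zero [simp]: "a \<oplus> \<zero> = a"
  using sat_axiom[of 1 "Equal (Add (Var 0) Zero) (Var 0)" "\<lambda>_. a"] by (simp add: PA_def)

lemma add_succ [simp]: "a \<oplus> \<S> b = \<S> (a \<oplus> b)"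
  using sat_axiom[of 2 "Equal (Add (Var 0) (Succ (Var 1))) (Succ (Add (Var 0) (Var 1)))"
      "case_nat a (\<lambda>_. b)"]
  by (simp add: PA_def)

lemma mult_zero [simp]: "a \<otimes> \<zero> = \<zero>"
  using sat_axiom[of 1 "Equal (Mul (Var 0) Zero) Zero" "\<lambda>_. a"] by (simp add: PA_def)

lemma mult_succ [simp]: "a \<otimes> \<S> b = a \<otimes> b \<oplus> a"
  using sat_axiom[of 2 "Equal (Mul (Var 0) (Succ (Var 1))) (Add (Mul (Var 0) (Var 1)) (Var 0))"
      "case_nat a (\<lambda>_. b)"]
  by (simp add: PA_def)

lemma induction:
  assumes "wf_fm F \<phi>" and "sat M (case_nat \<zero> e) \<phi>"
    and "\<And>a. sat M (case_nat a e) \<phi> \<Longrightarrow> sat M (case_nat (\<S> a) e) \<phi>"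
  shows "sat M (case_nat a e) \<phi>"
proof -
  obtain n where "fv (Forall \<phi>) \<subseteq> {..<n}" by (rule fv_bounded)
  then have "alls n (induction_fm \<phi>) \<in> PA F" using assms(1) unfolding PA_def by blast
  then have "sat M e (induction_fm \<phi>)" by (rule sat_axiom)
  then show ?thesis using assms(2,3) by (simp add: induction_fm_def sat_subst val_case_nat)
qed

lemma zero_add [simp]: "\<zero> \<oplus> a = a"
  using induction[of "Equal (Add Zero (Var 0)) (Var 0)" "\<lambda>_. a" a] by simp

lemma succ_add [simp]: "\<S> a \<oplus> b = \<S> (a \<oplus> b)"
  using induction[of "Equal (Add (Succ (Var 1)) (Var 0)) (Succ (Add (Var 1) (Var 0)))" "\<lambda>_. a" b]
  by simp

lemma add_assoc: "a \<oplus> b \<oplus> c = a \<oplus> (b \<oplus> c)"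
  using induction[of "Equal (Add (Add (Var 1) (Var 2)) (Var 0)) (Add (Var 1) (Add (Var 2) (Var 0)))"
      "case_nat a (\<lambda>_. b)" c]
  by (simp add: numeral_2_eq_2)

lemma add_right_cancel: "b \<oplus> a = c \<oplus> a \<Longrightarrow> b = c"
  using induction[of "Impl (Equal (Add (Var 1) (Var 0)) (Add (Var 2) (Var 0)))
      (Equal (Var 1) (Var 2))" "case_nat b (\<lambda>_. c)" a]
  by (simp add: numeral_2_eq_2)

lemma zero_or_succ: "a = \<zero> \<or> (\<exists>b. a = \<S> b)"
  using induction[of "Disj (Equal (Var 0) Zero) (Exists (Equal (Var 1) (Succ (Var 0))))" "\<lambda>_. a" a]
  by simp

lemma not_less_zero [simp]: "\<not> a \<prec> \<zero>"
  by (simp add: struct_less_def struct_le_def)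

lemma less_succ_iff_le: "a \<prec> \<S> b \<longleftrightarrow> a \<preceq> b"
  by (simp add: struct_less_def struct_le_def)

lemma le_iff: "a \<preceq> b \<longleftrightarrow> a = b \<or> a \<prec> b"
proof
  assume "a \<preceq> b"
  then obtain c where "c \<oplus> a = b" by (auto simp: struct_le_def)
  with zero_or_succ[of c] show "a = b \<or> a \<prec> b" by (auto simp: struct_less_def struct_le_def)
next
  have "a \<preceq> a" unfolding struct_le_def using zero_add by blast
  moreover have "a \<preceq> b" if "a \<prec> b"
    using that unfolding struct_less_def struct_le_def by (metis add_succ succ_add)
  ultimately show "a = b \<or> a \<prec> b \<Longrightarrow> a \<preceq> b" by blast
qed

lemma less_succ_iff: "a \<prec> \<S> b \<longleftrightarrow> a = b \<or> a \<prec> b"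
  by (simp add: less_succ_iff_le le_iff)

lemma le_or_less: "a \<preceq> b \<or> b \<prec> a"
proof -
  let ?\<phi> = "Disj (leq (Var 0) (Var 1)) (lt (Var 1) (Var 0))"
  have "sat M (case_nat a (\<lambda>_. b)) ?\<phi>"
  proof (rule induction)
    have "\<zero> \<preceq> b" unfolding struct_le_def using add_zero by blast
    then show "sat M (case_nat \<zero> (\<lambda>_. b)) ?\<phi>" by simp
  next
    fix a assume "sat M (case_nat a (\<lambda>_. b)) ?\<phi>"
    then consider "a = b" | "\<S> a \<preceq> b" | "b \<prec> a"
      by (auto simp: le_iff[of a b] struct_less_def[of _ a b])
    then show "sat M (case_nat (\<S> a) (\<lambda>_. b)) ?\<phi>" by cases (auto simp: less_succ_iff)
  qed simp
  then show ?thesis by simp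
qed

lemma less_imp_not_le: "b \<prec> a \<Longrightarrow> \<not> a \<preceq> b"
proof
  assume "b \<prec> a" "a \<preceq> b"
  then obtain c d where "c \<oplus> \<S> b = a" "d \<oplus> a = b" by (auto simp: struct_less_def struct_le_def)
  then have "\<S> (c \<oplus> d) \<oplus> a = \<zero> \<oplus> a" by (simp add: add_assoc)
  then have "\<S> (c \<oplus> d) = \<zero>" by (rule add_right_cancel)
  then show False by simp
qed

lemma not_le_iff: "\<not> a \<preceq> b \<longleftrightarrow> b \<prec> a"
  using le_or_less less_imp_not_le by blast

lemma neq_iff: "a \<noteq> b \<longleftrightarrow> a \<prec> b \<or> b \<prec> a"
  using le_iff less_imp_not_le le_or_less by metis

lemma constituents_in: "f \<in> F \<Longrightarrow> g \<in> constituents f \<Longrightarrow> g \<in> F"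
  and wf_pf_in: "f \<in> F \<Longrightarrow> wf_pf f"
  and num_pf_in: "num_pf \<in> F"
  using admissible by (auto simp: admissible_def)

lemma sat_defining_axiom: "f \<in> F \<Longrightarrow> alls n \<phi> \<in> defining_axioms f \<Longrightarrow> sat M e \<phi>"
  by (rule sat_axiom) (auto simp: PA_def)

lemma func_PZero: "PZero n \<in> F \<Longrightarrow> length as = n \<Longrightarrow> func M (PZero n) as = \<zero>"
  using sat_defining_axiom[of "PZero n" n _ "\<lambda>i. as ! i"]
  by (auto simp: comp_def map_nth)

lemma func_PSucc: "PSucc \<in> F \<Longrightarrow> func M PSucc [a] = \<S> a"
  using sat_defining_axiom[of PSucc 1 _ "\<lambda>i. a"] by auto

lemma func_PProj: "PProj n i \<in> F \<Longrightarrow> length as = n \<Longrightarrow> func M (PProj n i) as = as ! i"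
  using sat_defining_axiom[of "PProj n i" n _ "\<lambda>i. as ! i"]
  by (auto simp: comp_def map_nth)

lemma func_PComp:
  "PComp n g hs \<in> F \<Longrightarrow> length as = n \<Longrightarrow>
    func M (PComp n g hs) as = func M g (map (\<lambda>h. func M h as) hs)"
  using sat_defining_axiom[of "PComp n g hs" n _ "\<lambda>i. as ! i"]
  by (auto simp: comp_def map_nth)

lemma func_PRec_zero:
  assumes "PRec g h \<in> F" "length as = arity g"
  shows "func M (PRec g h) (\<zero> # as) = func M g as"
proof -
  let ?xs = "map Var [0..<arity g]"
  have "sat M (\<lambda>i. as ! i) (Equal (Fn (PRec g h) (Zero # ?xs)) (Fn g ?xs))"
    by (rule sat_defining_axiom[OF assms(1), of "arity g"]) (simp add: Let_def)
  then show ?thesis using map_nth[of as] assms(2) by (simp add: comp_def)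
qed

lemma func_PRec_succ:
  assumes "PRec g h \<in> F" "length as = arity g"
  shows "func M (PRec g h) (\<S> a # as) = func M h (a # func M (PRec g h) (a # as) # as)"
proof -
  let ?xs = "map Var [1..<Suc (arity g)]"
  have "sat M (\<lambda>i. (a # as) ! i) (Equal (Fn (PRec g h) (Succ (Var 0) # ?xs))
      (Fn h (Var 0 # Fn (PRec g h) (Var 0 # ?xs) # ?xs)))"
    by (rule sat_defining_axiom[OF assms(1), of "Suc (arity g)"]) (simp add: Let_def)
  moreover have "map (\<lambda>i. (a # as) ! i) [Suc 0..<Suc (arity g)] = as"
    using map_nth[of as] assms(2) by (simp add: map_Suc_upt[symmetric] comp_def del: upt_Suc)
  ultimately show ?thesis by (simp add: comp_def del: upt_Suc)
qed

lemma standard_add: "standard M (m + n) = standard M m \<oplus> standard M n"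
  by (induction n) simp_all

lemma standard_mult: "standard M (m * n) = standard M m \<otimes> standard M n"
  by (induction n) (simp_all add: standard_add add.commute[of m])

lemma func_PRec_standard:
  assumes "PRec g h \<in> F" "length ks = arity g"
    and g: "func M g (map (standard M) ks) = standard M (peval g ks)"
    and h: "\<And>k r. func M h (map (standard M) (k # r # ks)) = standard M (peval h (k # r # ks))"
  shows "func M (PRec g h) (map (standard M) (k # ks)) = standard M (peval (PRec g h) (k # ks))"
proof (induction k)
  case 0
  then show ?case using assms by (simp add: func_PRec_zero)
next
  case (Suc k)
  then show ?case
    using func_PRec_succ[OF assms(1), of "map (standard M) ks" "standard M k"] assms(2)
      h[of k "peval (PRec g h) (k # ks)"]
    by simp
qed

lemma func_standard:
  "f \<in> F \<Longrightarrow> length ns = arity f \<Longrightarrow> func M f (map (standard M) ns) = standard M (peval f ns)"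
proof (induction f arbitrary: ns)
  case (PZero n)
  then show ?case by (simp add: func_PZero)
next
  case PSucc
  then show ?case by (auto simp: length_Suc_conv func_PSucc)
next
  case (PProj n i)
  then show ?case using wf_pf_in[of "PProj n i"] by (simp add: func_PProj)
next
  case (PComp n g hs)
  have F: "g \<in> F" "set hs \<subseteq> F" "length hs = arity g" "\<forall>h\<in>set hs. arity h = n"
    using constituents_in[OF PComp.prems(1)] wf_pf_in[OF PComp.prems(1)] by auto
  let ?rs = "map (\<lambda>h. peval h ns) hs"
  have "func M (PComp n g hs) (map (standard M) ns) =
      func M g (map (\<lambda>h. func M h (map (standard M) ns)) hs)"
    using PComp.prems by (intro func_PComp) simp_all
  also have "map (\<lambda>h. func M h (map (standard M) ns)) hs = map (standard M) ?rs"
    using F PComp.prems by (auto simp: PComp.IH(2))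
  also have "func M g (map (standard M) ?rs) = standard M (peval g ?rs)"
    using F by (intro PComp.IH(1)) simp_all
  finally show ?case by simp
next
  case (PRec g h)
  have "g \<in> F" "h \<in> F" "arity h = arity g + 2"
    using constituents_in[OF PRec.prems(1)] wf_pf_in[OF PRec.prems(1)] by auto
  moreover obtain k ks where ns: "ns = k # ks" "length ks = arity g"
    using PRec.prems by (auto simp: length_Suc_conv)
  ultimately show ?case
    unfolding ns(1) by (intro func_PRec_standard PRec.prems(1) PRec.IH) simp_all
qed

lemma val_standard: "wf_tm F t \<Longrightarrow> val M (\<lambda>i. standard M (e i)) t = standard M (eval_tm e t)"
proof (induction t)
  case (Fn f ts)
  then have "map (val M (\<lambda>i. standard M (e i))) ts = map (standard M) (map (eval_tm e) ts)" by simp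
  then show ?case
    using Fn.prems func_standard[of f "map (eval_tm e) ts"] by (simp del: map_map map_eq_conv)
qed (simp_all add: standard_add standard_mult)

lemma func_const_pf:
  "const_pf n k \<in> F \<Longrightarrow> length as = n \<Longrightarrow> func M (const_pf n k) as = standard M k"
proof (induction k)
  case (Suc k)
  then have "const_pf n k \<in> F" "PSucc \<in> F" using constituents_in[OF Suc.prems(1)] by auto
  then show ?case using Suc by (simp add: func_PComp func_PSucc)
qed (simp add: func_PZero)

lemma func_num_pf_zero: "func M num_pf [\<zero>] = standard M (gn_tm Zero)"
  using func_standard[OF num_pf_in, of "[0]"] by (simp add: num_pf_def)

lemma func_num_pf_succ: "func M num_pf [\<S> a] = func M pair_pf [standard M 2, func M num_pf [a]]"
proof -
  let ?g = "const_pf 0 (gn_tm Zero)" and ?h = "PComp 2 pair_pf [const_pf 2 2, PProj 2 1]"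
  have F: "PRec ?g ?h \<in> F" using num_pf_in by (simp add: num_pf_def)
  then have h: "?h \<in> F" using constituents_in by fastforce
  then have "const_pf 2 2 \<in> F" "PProj 2 1 \<in> F" using constituents_in[OF h] by auto
  then show ?thesis
    using func_PRec_succ[OF F, of "[]" a] func_PComp[OF h] func_const_pf[of 2 2] func_PProj[of 2 1]
    by (simp add: num_pf_def)
qed

end

lemma models_imp_pa_model:
  assumes "admissible F" "extends F S (PA F)" "models M S"
  shows "pa_model F M"
proof unfold_locales
  show "models M (PA F)"
    using assms wf_PA models_deriv unfolding models_def extends_def by (metis deriv.Assm)
qed (rule assms(1))


section \<open>Values of dotted Goedel number terms\<close>

lemma wf_list_tm: "pair_pf \<in> F \<Longrightarrow> \<forall>t\<in>set ts. wf_tm F t \<Longrightarrow> wf_tm F (list_tm ts)"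
  by (induction ts) auto

lemma wf_dot_tm: "admissible F \<Longrightarrow> wf_tm F (dot_tm k t)"
  by (induction t) (auto simp: admissible_def intro!: wf_list_tm)

lemma wf_dot_fm: "admissible F \<Longrightarrow> wf_tm F (dot_fm k \<phi>)"
  by (induction \<phi> arbitrary: k) (auto simp: admissible_def wf_dot_tm)

lemma wf_dot_quote: "admissible F \<Longrightarrow> wf_tm F (dot_quote \<phi>)"
  by (simp add: dot_quote_def wf_dot_fm)

text \<open>
  A variable is coded in \<open>M\<close> like the numeral of its value. In models of PA so are \<open>0\<close> and the
  successor of a variable, by the recursion equations for the code of a numeral.
\<close>

definition numeral_coded :: "'a struct \<Rightarrow> (nat \<Rightarrow> 'a) \<Rightarrow> tm \<Rightarrow> 'a \<Rightarrow> bool" where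
  "numeral_coded M e t a \<longleftrightarrow> val M e (dot_tm 0 t) = func M num_pf [a]"

lemma numeral_coded_Var [simp]: "e i = a \<Longrightarrow> numeral_coded M e (Var i) a"
  by (auto simp: numeral_coded_def)

lemma numeral_coded_case_nat [simp]:
  "numeral_coded M e t a \<Longrightarrow> (\<And>i. numeral_coded M e (\<sigma> i) (e' i)) \<Longrightarrow>
    numeral_coded M e (case_nat t \<sigma> i) (case_nat a e' i)"
  by (cases i) simp_all

lemma funpow_up:
  "(up ^^ k) \<sigma> i = (if i < k then Var i else subst_tm (\<lambda>j. Var (j + k)) (\<sigma> (i - k)))"
proof (induction k arbitrary: i)
  case (Suc k)
  then show ?case by (cases i) (simp_all add: lift_tm_def subst_tm_subst_tm)
qed simp

lemma dot_tm_shift: "dot_tm k (subst_tm (\<lambda>j. Var (j + k)) t) = dot_tm 0 t"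
  by (induction t) (simp_all cong: map_cong)

lemma val_list_tm:
  "map (val M e) ts = map (val M e') us \<Longrightarrow> val M e (list_tm ts) = val M e' (list_tm us)"
proof (induction ts arbitrary: us)
  case (Cons t ts)
  then show ?case by (cases us) auto
qed simp

lemma val_dot_tm_subst:
  assumes "\<And>i. numeral_coded M e (\<sigma> i) (e' i)"
  shows "val M e (dot_tm k (subst_tm ((up ^^ k) \<sigma>) t)) = val M e' (dot_tm k t)"
proof (induction t)
  case (Var i)
  show ?case using assms[of "i - k"] by (simp add: funpow_up dot_tm_shift numeral_coded_def)
next
  case (Fn f ts)
  then have "val M e (list_tm (map (dot_tm k) (map (subst_tm ((up ^^ k) \<sigma>)) ts))) =
      val M e' (list_tm (map (dot_tm k) ts))"
    by (intro val_list_tm) simp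
  then show ?case by simp
qed simp_all

lemma val_dot_fm_subst:
  assumes "\<And>i. numeral_coded M e (\<sigma> i) (e' i)"
  shows "val M e (dot_fm k (subst ((up ^^ k) \<sigma>) \<phi>)) = val M e' (dot_fm k \<phi>)"
proof (induction \<phi> arbitrary: k)
  case (Forall \<phi>)
  show ?case using Forall[of "Suc k"] by simp
next
  case (Exists \<phi>)
  show ?case using Exists[of "Suc k"] by simp
qed (simp_all add: val_dot_tm_subst[OF assms])

lemma val_dot_quote_subst:
  assumes "\<And>i. numeral_coded M e (\<sigma> i) (e' i)"
  shows "val M e (dot_quote (subst \<sigma> \<phi>)) = val M e' (dot_quote \<phi>)"
  using val_dot_fm_subst[OF assms, of 0] by (simp add: dot_quote_def)

lemma numeral_coded_lift: "numeral_coded M e (lift_tm t) a \<longleftrightarrow> numeral_coded M (\<lambda>i. e (Suc i)) t a"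
  using val_dot_tm_subst[of M e "\<lambda>i. Var (Suc i)" "\<lambda>i. e (Suc i)" 0 t]
  by (simp add: numeral_coded_def lift_tm_def)

context pa_model
begin

lemma numeral_coded_Zero [simp]: "numeral_coded M e Zero \<zero>"
  by (simp add: numeral_coded_def func_num_pf_zero)

lemma numeral_coded_Succ_Var [simp]: "\<S> (e i) = a \<Longrightarrow> numeral_coded M e (Succ (Var i)) a"
  by (auto simp add: numeral_coded_def func_num_pf_succ)

lemma val_dot_quote_sentence:
  assumes "fv \<phi> = {}"
  shows "val M e (dot_quote \<phi>) = val M e (quote \<phi>)"
proof -
  have "val M e (dot_quote \<phi>) = val M e (dot_quote (subst (\<lambda>i. Zero) \<phi>))"
    using assms by (simp add: subst_sentence)
  also have "\<dots> = val M (\<lambda>i. standard M 0) (dot_quote \<phi>)" by (rule val_dot_quote_subst) simp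
  also have "\<dots> = standard M (eval_tm (\<lambda>i. 0) (dot_quote \<phi>))"
    by (rule val_standard) (rule wf_dot_quote[OF admissible])
  also have "\<dots> = standard M (gn \<phi>)" using assms by (simp add: eval_dot_quote subst_sentence)
  finally show ?thesis by (simp add: quote_def)
qed

end


section \<open>Provable completeness inside a model\<close>

definition pa_entails :: "pfun set \<Rightarrow> fm \<Rightarrow> fm \<Rightarrow> bool" where
  "pa_entails F \<phi> \<psi> \<longleftrightarrow> (\<forall>(M :: nat struct) e. pa_model F M \<longrightarrow> sat M e \<phi> \<longrightarrow> sat M e \<psi>)"

lemma pa_entailsI:
  "(\<And>(M :: nat struct) e. pa_model F M \<Longrightarrow> sat M e \<phi> \<Longrightarrow> sat M e \<psi>) \<Longrightarrow> pa_entails F \<phi> \<psi>"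
  by (simp add: pa_entails_def)

lemma pa_entailsD:
  fixes M :: "nat struct"
  shows "pa_entails F \<phi> \<psi> \<Longrightarrow> pa_model F M \<Longrightarrow> sat M e \<phi> \<Longrightarrow> sat M e \<psi>"
  by (simp add: pa_entails_def)

text \<open>
  In \<open>t\<close> the variable 0 is the recursion argument; in \<open>s\<close> the variable 0 is the previous value and the
  variable 1 its argument.
\<close>

definition pa_recursion :: "pfun set \<Rightarrow> tm \<Rightarrow> tm \<Rightarrow> tm \<Rightarrow> bool" where
  "pa_recursion F t u s \<longleftrightarrow> (\<forall>M :: nat struct. pa_model F M \<longrightarrow>
     (\<forall>e. val M (case_nat \<zero>\<^bsub>M\<^esub> e) t = val M e u) \<and>
     (\<forall>e a. val M (case_nat (\<S>\<^bsub>M\<^esub> a) e) t =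
       val M (case_nat (val M (case_nat a e) t) (case_nat a e)) s))"

lemma pa_recursion_zero:
  fixes M :: "nat struct"
  shows "pa_recursion F t u s \<Longrightarrow> pa_model F M \<Longrightarrow> val M (case_nat \<zero>\<^bsub>M\<^esub> e) t = val M e u"
  by (simp add: pa_recursion_def)

lemma pa_recursion_succ:
  fixes M :: "nat struct"
  shows "pa_recursion F t u s \<Longrightarrow> pa_model F M \<Longrightarrow> val M (case_nat (\<S>\<^bsub>M\<^esub> a) e) t =
    val M (case_nat (val M (case_nat a e) t) (case_nat a e)) s"
  by (simp add: pa_recursion_def)

locale provability_formula = pa_model F M for F and M :: "nat struct" (structure) +
  fixes \<Phi> :: fm
  assumes wf_\<Phi>: "wf_fm F \<Phi>" and fv_\<Phi>: "fv \<Phi> \<subseteq> {0}"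
    and entails_closed: "wf_fm F \<phi> \<Longrightarrow> wf_fm F \<psi> \<Longrightarrow> pa_entails F \<phi> \<psi> \<Longrightarrow>
      sat M e (inst \<Phi> (dot_quote \<phi>)) \<Longrightarrow> sat M e (inst \<Phi> (dot_quote \<psi>))"
begin

definition provable :: "(nat \<Rightarrow> nat) \<Rightarrow> fm \<Rightarrow> bool" where
  "provable e \<phi> \<longleftrightarrow> wf_fm F \<phi> \<and> sat M e (inst \<Phi> (dot_quote \<phi>))"

lemma provable_imp_wf: "provable e \<phi> \<Longrightarrow> wf_fm F \<phi>"
  by (simp add: provable_def)

lemma provable_mono: "provable e \<phi> \<Longrightarrow> wf_fm F \<psi> \<Longrightarrow> pa_entails F \<phi> \<psi> \<Longrightarrow> provable e \<psi>"
  unfolding provable_def using entails_closed by blast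

lemma provable_cong:
  assumes "val M e (dot_quote \<phi>) = val M e' (dot_quote \<psi>)" "wf_fm F \<phi> = wf_fm F \<psi>"
  shows "provable e \<phi> \<longleftrightarrow> provable e' \<psi>"
proof -
  have "sat M (case_nat a e) \<Phi> = sat M (case_nat a e') \<Phi>" for a
    using fv_\<Phi> by (intro sat_cong) auto
  then show ?thesis using assms by (simp add: provable_def)
qed

lemma provable_subst:
  assumes "\<And>i. wf_tm F (\<sigma> i)" "\<And>i. numeral_coded M e (\<sigma> i) (e' i)"
  shows "provable e (subst \<sigma> \<phi>) \<longleftrightarrow> provable e' \<phi>"
  using assms by (intro provable_cong val_dot_quote_subst) simp_all

lemma provable_substD:
  "provable e (subst \<sigma> \<phi>) \<Longrightarrow> (\<And>i. wf_tm F (\<sigma> i)) \<Longrightarrow> (\<And>i. numeral_coded M e (\<sigma> i) (e' i)) \<Longrightarrow>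
    provable e' \<phi>"
  using provable_subst by blast

lemma provable_shift: "provable e (subst (\<lambda>i. Var (i + k)) \<phi>) \<longleftrightarrow> provable (\<lambda>i. e (i + k)) \<phi>"
  by (rule provable_subst) simp_all

lemma provable_lift [simp]: "provable e (lift \<phi>) \<longleftrightarrow> provable (\<lambda>i. e (Suc i)) \<phi>"
  using provable_shift[of e 1] by (simp add: lift_def)

lemma provable_induct:
  assumes wf: "\<And>i. wf_tm F (\<sigma> i)" "wf_fm F \<phi>" "wf_fm F \<psi>"
    and E: "\<And>a. E a = (\<lambda>i. val M (case_nat a e) (\<sigma> i))"
    and zero: "sat M (case_nat \<zero> e) \<psi> \<Longrightarrow> provable (E \<zero>) \<phi>"
    and succ: "\<And>a. (sat M (case_nat a e) \<psi> \<Longrightarrow> provable (E a) \<phi>) \<Longrightarrow>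
      sat M (case_nat (\<S> a) e) \<psi> \<Longrightarrow> provable (E (\<S> a)) \<phi>"
    and "sat M (case_nat a e) \<psi>"
  shows "provable (E a) \<phi>"
proof -
  let ?\<theta> = "Impl \<psi> (subst \<sigma> (inst \<Phi> (dot_quote \<phi>)))"
  have sat_\<theta>: "sat M (case_nat b e) ?\<theta> \<longleftrightarrow> (sat M (case_nat b e) \<psi> \<longrightarrow> provable (E b) \<phi>)" for b
    using wf(2) by (simp add: sat_subst provable_def E)
  have "sat M (case_nat a e) ?\<theta>"
  proof (rule induction)
    show "wf_fm F ?\<theta>" using wf(1,3) wf_\<Phi> by (simp add: wf_dot_quote[OF admissible])
    show "sat M (case_nat \<zero> e) ?\<theta>" unfolding sat_\<theta> using zero by blast
    show "sat M (case_nat (\<S> b) e) ?\<theta>" if "sat M (case_nat b e) ?\<theta>" for b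
      using that succ unfolding sat_\<theta> by blast
  qed
  with \<open>sat M (case_nat a e) \<psi>\<close> show ?thesis unfolding sat_\<theta> by blast
qed

definition reflected :: "fm \<Rightarrow> bool" where
  "reflected \<phi> \<longleftrightarrow> wf_fm F \<phi> \<and>
     (\<forall>\<psi> e. sat M e \<phi> \<longrightarrow> provable e \<psi> \<longrightarrow> provable e (Conj \<psi> \<phi>))"

definition evaluated :: "tm \<Rightarrow> bool" where
  "evaluated t \<longleftrightarrow> reflected (Equal (Var 0) (lift_tm t))"

lemma reflectedI:
  assumes "wf_fm F \<phi>"
    and "\<And>\<psi> e. sat M e \<phi> \<Longrightarrow> provable e \<psi> \<Longrightarrow> provable e (Conj \<psi> \<phi>)"
  shows "reflected \<phi>"
  using assms by (simp add: reflected_def)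

lemma reflectedD: "reflected \<phi> \<Longrightarrow> sat M e \<phi> \<Longrightarrow> provable e \<psi> \<Longrightarrow> provable e (Conj \<psi> \<phi>)"
  by (simp add: reflected_def)

lemma reflected_imp_wf: "reflected \<phi> \<Longrightarrow> wf_fm F \<phi>"
  by (simp add: reflected_def)

lemma evaluated_imp_wf: "evaluated t \<Longrightarrow> wf_tm F t"
  using reflected_imp_wf by (fastforce simp: evaluated_def)

lemma pa_model_self: "pa_model F M"
  by unfold_locales

lemma reflected_cong:
  assumes "reflected \<phi>" "wf_fm F \<psi>" "pa_entails F \<phi> \<psi>" "pa_entails F \<psi> \<phi>"
  shows "reflected \<psi>"
proof (rule reflectedI[OF assms(2)])
  fix \<chi> e assume "sat M e \<psi>" and \<chi>: "provable e \<chi>"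
  then have "sat M e \<phi>" using assms(4) pa_model_self by (blast dest: pa_entailsD)
  with assms(1) have "provable e (Conj \<chi> \<phi>)" using \<chi> by (rule reflectedD)
  then show "provable e (Conj \<chi> \<psi>)"
    by (rule provable_mono) (use assms(2,3) provable_imp_wf[OF \<chi>] in \<open>auto simp: pa_entails_def\<close>)
qed

lemma reflected_Conj:
  assumes "reflected \<phi>" "reflected \<psi>"
  shows "reflected (Conj \<phi> \<psi>)"
proof (rule reflectedI)
  fix \<chi> e assume "sat M e (Conj \<phi> \<psi>)" and "provable e \<chi>"
  then have "provable e (Conj (Conj \<chi> \<phi>) \<psi>)" using assms by (simp add: reflectedD)
  then show "provable e (Conj \<chi> (Conj \<phi> \<psi>))"
    by (rule provable_mono)
      (use assms \<open>provable e \<chi>\<close> in \<open>auto simp: pa_entails_def provable_imp_wf reflected_imp_wf\<close>)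
qed (use assms in \<open>simp add: reflected_imp_wf\<close>)

lemma reflected_Disj:
  assumes "reflected \<phi>" "reflected \<psi>"
  shows "reflected (Disj \<phi> \<psi>)"
proof (rule reflectedI)
  fix \<chi> e assume "sat M e (Disj \<phi> \<psi>)" and \<chi>: "provable e \<chi>"
  then have "provable e (Conj \<chi> \<phi>) \<or> provable e (Conj \<chi> \<psi>)" using assms by (auto simp: reflectedD)
  moreover have "wf_fm F (Conj \<chi> (Disj \<phi> \<psi>))"
    using assms \<chi> by (simp add: provable_imp_wf reflected_imp_wf)
  ultimately show "provable e (Conj \<chi> (Disj \<phi> \<psi>))"
    by (auto intro: provable_mono simp: pa_entails_def)
qed (use assms in \<open>simp add: reflected_imp_wf\<close>)

lemma reflected_Exists:
  assumes "reflected \<phi>"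
  shows "reflected (Exists \<phi>)"
proof (rule reflectedI)
  fix \<psi> e assume "sat M e (Exists \<phi>)" and \<psi>: "provable e \<psi>"
  then obtain a where "sat M (case_nat a e) \<phi>" by auto
  then have "provable (case_nat a e) (Conj (lift \<psi>) \<phi>)" using assms \<psi> by (intro reflectedD) simp_all
  then have "provable (case_nat a e) (lift (Conj \<psi> (Exists \<phi>)))"
  proof (rule provable_mono)
    show "pa_entails F (Conj (lift \<psi>) \<phi>) (lift (Conj \<psi> (Exists \<phi>)))"
      by (rule pa_entailsI) (simp, metis case_nat_0_Suc)
  qed (use assms \<psi> in \<open>simp add: provable_imp_wf reflected_imp_wf\<close>)
  then show "provable e (Conj \<psi> (Exists \<phi>))" by simp
qed (use assms in \<open>simp add: reflected_imp_wf\<close>)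

text \<open>
  The variables of the side formula \<open>\<psi>\<close> can be renamed apart from those of \<open>\<phi>\<close>, so it is enough to
  treat side formulas in which the first \<open>m\<close> variables do not occur.
\<close>

lemma reflected_substI:
  assumes "wf_fm F \<phi>"
    and step: "\<And>\<psi> e. sat M e \<phi> \<Longrightarrow> provable (\<lambda>i. e (i + m)) \<psi> \<Longrightarrow>
      provable e (Conj (subst (\<lambda>i. Var (i + m)) \<psi>) \<phi>)"
    and \<sigma>: "\<And>i. wf_tm F (\<sigma> i)" "\<And>e i. numeral_coded M e (\<sigma> i) (val M e (\<sigma> i))"
  shows "reflected (subst \<sigma> \<phi>)"
proof (rule reflectedI)
  fix \<psi> e assume sat: "sat M e (subst \<sigma> \<phi>)" and \<psi>: "provable e \<psi>"
  obtain n where n: "fv \<phi> \<subseteq> {..<n}" by (rule fv_bounded)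
  define k where "k = n + m"
  define d where "d i = (if i < k then val M e (\<sigma> i) else e (i - k))" for i
  define \<rho> where "\<rho> i = (if i < k then \<sigma> i else Var (i - k))" for i
  have "(\<lambda>i. d (i + m + n)) = e" by (rule ext) (simp add: d_def k_def)
  then have \<psi>': "provable (\<lambda>i. d (i + m)) (subst (\<lambda>i. Var (i + n)) \<psi>)"
    using \<psi> by (simp add: provable_shift add.assoc add.commute[of m])
  have "sat M d \<phi> \<longleftrightarrow> sat M (\<lambda>i. val M e (\<sigma> i)) \<phi>"
    using n by (intro sat_cong) (auto simp: d_def k_def)
  then have "sat M d \<phi>" using sat by (simp add: sat_subst)
  from step[OF this \<psi>'] have "provable d (Conj (subst (\<lambda>i. Var (i + k)) \<psi>) \<phi>)"
    by (simp add: subst_subst k_def add.assoc)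
  then have "provable e (subst \<rho> (Conj (subst (\<lambda>i. Var (i + k)) \<psi>) \<phi>))"
    using \<sigma> by (subst provable_subst[where e' = d]) (auto simp: \<rho>_def d_def)
  moreover have "subst \<rho> \<phi> = subst \<sigma> \<phi>" using n by (intro subst_cong) (auto simp: \<rho>_def k_def)
  ultimately show "provable e (Conj \<psi> (subst \<sigma> \<phi>))" by (simp add: subst_subst \<rho>_def)
qed (use assms in simp)

lemma reflected_rename:
  assumes "reflected \<phi>"
  shows "reflected (subst (\<lambda>i. Var (r i)) \<phi>)"
  by (rule reflected_substI[where m = 0]) (use assms in \<open>simp_all add: reflected_imp_wf reflectedD\<close>)

lemma evaluated_lift:
  assumes "evaluated t"
  shows "evaluated (lift_tm t)"
  using reflected_rename[OF assms[unfolded evaluated_def], of "case_nat 0 (\<lambda>i. Suc (Suc i))"]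
  by (simp add: evaluated_def lift_tm_def subst_tm_subst_tm)

lemma reflected_inst:
  assumes \<phi>: "reflected \<phi>" and t: "evaluated t"
  shows "reflected (inst \<phi> t)"
proof (rule reflectedI)
  let ?eq = "Equal (Var 0) (lift_tm t)"
  fix \<psi> e assume sat: "sat M e (inst \<phi> t)" and \<psi>: "provable e \<psi>"
  let ?e = "case_nat (val M e t) e"
  have "provable ?e (Conj (lift \<psi>) ?eq)"
    using t \<psi> by (intro reflectedD) (simp_all add: evaluated_def)
  then have "provable ?e (Conj (Conj (lift \<psi>) ?eq) \<phi>)" using \<phi> sat by (simp add: reflectedD)
  then have "provable ?e (lift (Conj \<psi> (inst \<phi> t)))"
  proof (rule provable_mono)
    show "pa_entails F (Conj (Conj (lift \<psi>) ?eq) \<phi>) (lift (Conj \<psi> (inst \<phi> t)))"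
      by (rule pa_entailsI) (simp, metis case_nat_0_Suc)
  qed (use \<phi> t \<psi> in \<open>simp add: provable_imp_wf reflected_imp_wf evaluated_imp_wf\<close>)
  then show "provable e (Conj \<psi> (inst \<phi> t))" by simp
qed (use \<phi> t in \<open>simp add: reflected_imp_wf evaluated_imp_wf\<close>)

lemma reflected_subst_finite:
  assumes "finite A" "reflected \<phi>" "\<And>i. i \<in> A \<Longrightarrow> evaluated (\<sigma> i)" "\<And>i. i \<notin> A \<Longrightarrow> \<exists>j. \<sigma> i = Var j"
  shows "reflected (subst \<sigma> \<phi>)"
  using assms(1,3,4)
proof (induction A arbitrary: \<sigma>)
  case empty
  then obtain r where "\<sigma> = (\<lambda>i. Var (r i))" by (metis empty_iff ext)
  with assms(2) show ?case by (simp add: reflected_rename)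
next
  case (insert k A)
  define \<tau> where "\<tau> = (\<lambda>i. lift_tm (\<sigma> i))(k := Var 0)"
  have "reflected (subst \<tau> \<phi>)"
  proof (rule insert.IH)
    show "evaluated (\<tau> i)" if "i \<in> A" for i
      using that insert by (auto simp: \<tau>_def intro: evaluated_lift)
    show "\<exists>j. \<tau> i = Var j" if "i \<notin> A" for i
    proof (cases "i = k")
      case False
      with that insert.prems(2) obtain j where "\<sigma> i = Var j" by blast
      with False show ?thesis by (simp add: \<tau>_def)
    qed (simp add: \<tau>_def)
  qed
  then have "reflected (inst (subst \<tau> \<phi>) (\<sigma> k))"
    using insert.prems by (intro reflected_inst) simp_all
  moreover have "(\<lambda>i. subst_tm (case_nat (\<sigma> k) Var) (\<tau> i)) = \<sigma>" by (rule ext) (simp add: \<tau>_def)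
  ultimately show ?case by (simp add: inst_def subst_subst)
qed

lemma reflected_subst:
  assumes "reflected \<phi>" "\<And>i. evaluated (\<sigma> i)"
  shows "reflected (subst \<sigma> \<phi>)"
proof -
  have "reflected (subst (\<lambda>i. if i \<in> fv \<phi> then \<sigma> i else Var i) \<phi>)"
    using assms by (intro reflected_subst_finite[OF finite_fv[of \<phi>]]) simp_all
  moreover have "subst (\<lambda>i. if i \<in> fv \<phi> then \<sigma> i else Var i) \<phi> = subst \<sigma> \<phi>"
    by (rule subst_cong) simp
  ultimately show ?thesis by simp
qed

lemma evaluated_numeral_coded:
  assumes "wf_tm F t" "\<And>e. numeral_coded M e t (val M e t)"
  shows "evaluated t"
proof -
  have "reflected (subst (case_nat (Var 0) (\<lambda>_. lift_tm t)) (Equal (Var 0) (Var 1)))"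
  proof (rule reflected_substI[where m = 0])
    fix \<psi> e assume "sat M e (Equal (Var 0) (Var 1))" and "provable (\<lambda>i. e (i + 0)) \<psi>"
    then have eq: "e 0 = e 1" and \<psi>: "provable e \<psi>" by simp_all
    from \<psi> have "provable e (Conj \<psi> (Equal (Var 0) (Var 0)))"
      by (rule provable_mono) (use provable_imp_wf[OF \<psi>] in \<open>auto simp: pa_entails_def\<close>)
    moreover have "provable e (Conj \<psi> (Equal (Var 0) (Var 0))) \<longleftrightarrow>
        provable e (Conj \<psi> (Equal (Var 0) (Var 1)))"
      using eq by (intro provable_cong) (simp_all add: dot_quote_def)
    ultimately show "provable e (Conj (subst (\<lambda>i. Var (i + 0)) \<psi>) (Equal (Var 0) (Var 1)))"
      by simp
  next
    show "numeral_coded M e (case_nat (Var 0) (\<lambda>_. lift_tm t) i)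
        (val M e (case_nat (Var 0) (\<lambda>_. lift_tm t) i))" for e i
      using assms(2) by (cases i) (simp_all add: numeral_coded_lift)
  qed (use assms(1) in simp_all)
  then show ?thesis by (simp add: evaluated_def)
qed

lemma evaluated_Var: "evaluated (Var i)"
  by (rule evaluated_numeral_coded) simp_all

lemma evaluated_Zero: "evaluated Zero"
  by (rule evaluated_numeral_coded) simp_all

lemma evaluated_subst:
  assumes "evaluated t" "\<And>i. evaluated (\<sigma> i)"
  shows "evaluated (subst_tm \<sigma> t)"
proof -
  have "evaluated (up \<sigma> i)" for i
    using assms(2) by (cases i) (simp_all add: evaluated_Var evaluated_lift)
  then have "reflected (subst (up \<sigma>) (Equal (Var 0) (lift_tm t)))"
    by (rule reflected_subst[OF assms(1)[unfolded evaluated_def]])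
  then show ?thesis by (simp add: evaluated_def subst_tm_up_lift_tm)
qed

lemma evaluated_Succ:
  assumes "evaluated t"
  shows "evaluated (Succ t)"
proof -
  have "evaluated (Succ (Var 0))" by (rule evaluated_numeral_coded) simp_all
  from evaluated_subst[OF this, of "\<lambda>_. t"] assms show ?thesis by simp
qed

lemma evaluated_cong:
  assumes "evaluated t" "wf_tm F u"
    and "\<And>(M' :: nat struct) e. pa_model F M' \<Longrightarrow> val M' e t = val M' e u"
  shows "evaluated u"
  using assms unfolding evaluated_def
  by (auto elim!: reflected_cong simp: pa_entails_def)

lemma provable_rec_zero:
  assumes wf: "wf_tm F t" and u: "evaluated u" and rec: "pa_recursion F t u s"
    and \<psi>: "provable e \<psi>"
  shows "provable (case_nat (val M (case_nat \<zero> e) t) (case_nat \<zero> e))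
    (Conj (lift (lift \<psi>)) (Equal (Var 0) (lift_tm t)))" (is "provable _ ?\<chi>")
proof -
  let ?\<sigma> = "case_nat (Var 0) (case_nat Zero (\<lambda>i. Var (Suc i)))"
  let ?e = "case_nat (val M (case_nat \<zero> e) t) e"
  have "provable ?e (Conj (lift \<psi>) (Equal (Var 0) (lift_tm u)))"
    using u \<psi> pa_recursion_zero[OF rec pa_model_self]
    by (intro reflectedD) (simp_all add: evaluated_def)
  then have "provable ?e (subst ?\<sigma> ?\<chi>)"
    by (rule provable_mono)
      (use wf provable_imp_wf[OF \<psi>] in \<open>simp_all add: pa_entails_def sat_subst val_subst
        val_case_nat pa_recursion_zero[OF rec]\<close>)
  then show ?thesis by (rule provable_substD) simp_all
qed

lemma provable_rec_succ:
  assumes wf: "wf_tm F t" and s: "evaluated s" and rec: "pa_recursion F t u s"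
    and \<chi>: "provable (case_nat (val M (case_nat a e) t) (case_nat a e))
      (Conj (lift (lift \<psi>)) (Equal (Var 0) (lift_tm t)))" (is "provable ?e ?\<chi>")
  shows "provable (case_nat (val M (case_nat (\<S> a) e) t) (case_nat (\<S> a) e)) ?\<chi>"
proof -
  let ?\<sigma> = "case_nat (Var 0) (case_nat (Succ (Var 2)) (\<lambda>i. Var (Suc (Suc (Suc i)))))"
  let ?d = "case_nat (val M (case_nat (\<S> a) e) t) ?e"
  have "provable ?d (Conj (lift ?\<chi>) (Equal (Var 0) (lift_tm s)))"
    using s \<chi> pa_recursion_succ[OF rec pa_model_self]
    by (intro reflectedD) (simp_all add: evaluated_def)
  then have "provable ?d (subst ?\<sigma> ?\<chi>)"
  proof (rule provable_mono)
    show "pa_entails F (Conj (lift ?\<chi>) (Equal (Var 0) (lift_tm s))) (subst ?\<sigma> ?\<chi>)"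
    proof (rule pa_entailsI)
      fix M' :: "nat struct" and d
      assume M': "pa_model F M'" and "sat M' d (Conj (lift ?\<chi>) (Equal (Var 0) (lift_tm s)))"
      then show "sat M' d (subst ?\<sigma> ?\<chi>)"
        using case_nat_0_Suc[of "\<lambda>i. d (Suc i)"] case_nat_0_Suc[of "\<lambda>i. d (Suc (Suc i))"]
        by (simp add: sat_subst val_subst val_case_nat pa_recursion_succ[OF rec M'] numeral_2_eq_2)
    qed
  qed (use wf provable_imp_wf[OF \<chi>] in simp)
  then show ?thesis by (rule provable_substD) (simp_all add: numeral_2_eq_2)
qed

lemma evaluated_rec:
  assumes wf: "wf_tm F t" and u: "evaluated u" and s: "evaluated s" and rec: "pa_recursion F t u s"
  shows "evaluated t"
proof -
  let ?eq = "Equal (Var 0) (lift_tm t)"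
  have "reflected (subst Var ?eq)"
  proof (rule reflected_substI[where m = 2])
    fix \<psi> e assume sat: "sat M e ?eq" and "provable (\<lambda>i. e (i + 2)) \<psi>"
    then have \<psi>: "provable (\<lambda>i. e (Suc (Suc i))) \<psi>" by simp
    let ?d = "\<lambda>i. e (Suc (Suc i))" and ?\<chi> = "Conj (lift (lift \<psi>)) ?eq"
    let ?E = "\<lambda>a. case_nat (val M (case_nat a ?d) t) (case_nat a ?d)"
    have "provable (?E (e 1)) ?\<chi>"
    proof (rule provable_induct[where \<sigma> = "case_nat t Var" and \<psi> = "Neg Falsum" and e = ?d])
      show "?E a = (\<lambda>i. val M (case_nat a ?d) (case_nat t Var i))" for a by (simp add: val_case_nat)
      show "provable (?E \<zero>) ?\<chi>" using wf u rec \<psi> by (rule provable_rec_zero)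
      show "provable (?E (\<S> a)) ?\<chi>"
        if "sat M (case_nat a ?d) (Neg Falsum) \<Longrightarrow> provable (?E a) ?\<chi>" for a
        using that by (intro provable_rec_succ[OF wf s rec]) simp_all
    qed (use wf provable_imp_wf[OF \<psi>] in simp_all)
    moreover have "?E (e 1) = e"
      using sat case_nat_0_Suc[of e] case_nat_0_Suc[of "\<lambda>i. e (Suc i)"] by simp
    ultimately show "provable e (Conj (subst (\<lambda>i. Var (i + 2)) \<psi>) ?eq)"
      by (simp add: lift_def subst_subst)
  qed (use wf in simp_all)
  then show ?thesis by (simp add: evaluated_def)
qed

lemma evaluated_Add:
  assumes "evaluated t" "evaluated u"
  shows "evaluated (Add t u)"
proof -
  have "evaluated (Add (Var 1) (Var 0))"
    by (rule evaluated_rec[where u = "Var 0" and s = "Succ (Var 0)"])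
      (simp_all add: pa_recursion_def evaluated_Var evaluated_Succ pa_model.add_zero
        pa_model.add_succ)
  then have "evaluated (subst_tm (case_nat u (\<lambda>_. t)) (Add (Var 1) (Var 0)))"
    by (rule evaluated_subst) (use assms in \<open>simp split: nat.split\<close>)
  then show ?thesis by simp
qed

lemma evaluated_Mul:
  assumes "evaluated t" "evaluated u"
  shows "evaluated (Mul t u)"
proof -
  have "evaluated (Mul (Var 1) (Var 0))"
    by (rule evaluated_rec[where u = Zero and s = "Add (Var 0) (Var 2)"])
      (simp_all add: pa_recursion_def evaluated_Var evaluated_Zero evaluated_Add
        pa_model.mult_zero pa_model.mult_succ numeral_2_eq_2)
  then have "evaluated (subst_tm (case_nat u (\<lambda>_. t)) (Mul (Var 1) (Var 0)))"
    by (rule evaluated_subst) (use assms in \<open>simp split: nat.split\<close>)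
  then show ?thesis by simp
qed

lemma evaluated_Fn_Vars:
  assumes "evaluated (Fn f (map Var [0..<length ts]))" "\<forall>t\<in>set ts. evaluated t"
  shows "evaluated (Fn f ts)"
proof -
  have "evaluated (args ts i)" for i using assms(2) by (simp add: args_def evaluated_Zero)
  with assms(1) have "evaluated (subst_tm (args ts) (Fn f (map Var [0..<length ts])))"
    by (rule evaluated_subst)
  then show ?thesis by (simp only: subst_tm_args)
qed

lemma pa_recursion_PRec:
  assumes PRec: "PRec g h \<in> F"
  shows "pa_recursion F (Fn (PRec g h) (map Var [0..<Suc (arity g)]))
    (Fn g (map Var [0..<arity g]))
    (Fn h (Var 1 # Var 0 # map (\<lambda>i. Var (i + 2)) [0..<arity g]))" (is "pa_recursion F ?t ?u ?s")
  unfolding pa_recursion_def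
proof (intro allI impI conjI)
  fix M' :: "nat struct" and e a assume M': "pa_model F M'"
  have t: "val M' (case_nat b e) ?t = func M' (PRec g h) (b # map e [0..<arity g])" for b
    by (simp add: map_upt_Suc comp_def del: upt_Suc)
  show "val M' (case_nat \<zero>\<^bsub>M'\<^esub> e) ?t = val M' e ?u"
    unfolding t using pa_model.func_PRec_zero[OF M' PRec] by (simp add: comp_def)
  show "val M' (case_nat (\<S>\<^bsub>M'\<^esub> a) e) ?t =
      val M' (case_nat (val M' (case_nat a e) ?t) (case_nat a e)) ?s"
    unfolding t using pa_model.func_PRec_succ[OF M' PRec] by (simp add: comp_def numeral_2_eq_2)
qed

lemma evaluated_Fn_PRec:
  assumes PRec: "PRec g h \<in> F"
    and g: "\<And>ts. length ts = arity g \<Longrightarrow> \<forall>t\<in>set ts. evaluated t \<Longrightarrow> evaluated (Fn g ts)"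
    and h: "\<And>ts. length ts = arity h \<Longrightarrow> \<forall>t\<in>set ts. evaluated t \<Longrightarrow> evaluated (Fn h ts)"
  shows "evaluated (Fn (PRec g h) (map Var [0..<Suc (arity g)]))"
proof (rule evaluated_rec[OF _ _ _ pa_recursion_PRec[OF PRec]])
  show "wf_tm F (Fn (PRec g h) (map Var [0..<Suc (arity g)]))" using PRec by (simp del: upt_Suc)
  show "evaluated (Fn g (map Var [0..<arity g]))" by (rule g) (auto simp: evaluated_Var)
  show "evaluated (Fn h (Var 1 # Var 0 # map (\<lambda>i. Var (i + 2)) [0..<arity g]))"
    using wf_pf_in[OF PRec] by (intro h) (auto simp: evaluated_Var)
qed

lemma evaluated_Fn:
  "f \<in> F \<Longrightarrow> length ts = arity f \<Longrightarrow> \<forall>t\<in>set ts. evaluated t \<Longrightarrow> evaluated (Fn f ts)"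
proof (induction f arbitrary: ts)
  case (PZero n)
  show ?case
    by (rule evaluated_cong[OF evaluated_Zero])
      (use PZero in \<open>auto simp: pa_model.func_PZero evaluated_imp_wf\<close>)
next
  case PSucc
  then obtain t where t: "ts = [t]" "evaluated t" by (auto simp: length_Suc_conv)
  from t(2) have "evaluated (Succ t)" by (rule evaluated_Succ)
  then show ?case
    by (rule evaluated_cong) (use PSucc t in \<open>auto simp: pa_model.func_PSucc evaluated_imp_wf\<close>)
next
  case (PProj n i)
  then have i: "i < length ts" using wf_pf_in[OF PProj(1)] by simp
  then have "evaluated (ts ! i)" using PProj by simp
  then show ?case
  proof (rule evaluated_cong)
    show "val M' e (ts ! i) = val M' e (Fn (PProj n i) ts)" if "pa_model F M'"
      for M' :: "nat struct" and e
      using pa_model.func_PProj[OF that PProj(1)] PProj(2) i by simp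
  qed (use PProj in \<open>simp add: evaluated_imp_wf\<close>)
next
  case (PComp n g hs)
  have F: "g \<in> F" "set hs \<subseteq> F" and arity: "length hs = arity g" "\<forall>h\<in>set hs. arity h = n"
    using constituents_in[OF PComp.prems(1)] wf_pf_in[OF PComp.prems(1)] by auto
  have "evaluated (Fn g (map (\<lambda>h. Fn h ts) hs))"
    using F arity PComp.prems by (intro PComp.IH(1)) (auto simp: PComp.IH(2))
  then show ?case
    by (rule evaluated_cong)
      (use PComp.prems in \<open>auto simp: pa_model.func_PComp comp_def evaluated_imp_wf\<close>)
next
  case (PRec g h)
  have "g \<in> F" "h \<in> F" using constituents_in[OF PRec.prems(1)] by auto
  then have "evaluated (Fn (PRec g h) (map Var [0..<Suc (arity g)]))"
    by (intro evaluated_Fn_PRec PRec.prems(1) PRec.IH)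
  with PRec.prems show ?case by (simp add: evaluated_Fn_Vars del: upt_Suc)
qed

lemma wf_imp_evaluated: "wf_tm F t \<Longrightarrow> evaluated t"
proof (induction t)
  case (Fn f ts)
  then show ?case by (intro evaluated_Fn) simp_all
qed (simp_all add: evaluated_Var evaluated_Zero evaluated_Succ evaluated_Add evaluated_Mul)

lemma reflected_Equal:
  assumes "wf_tm F t" "wf_tm F u"
  shows "reflected (Equal t u)"
proof -
  have "reflected (Equal (Var 0) (lift_tm u))"
    using wf_imp_evaluated[OF assms(2)] by (simp add: evaluated_def)
  from reflected_inst[OF this wf_imp_evaluated[OF assms(1)]] show ?thesis by simp
qed

lemma reflected_leq: "wf_tm F t \<Longrightarrow> wf_tm F u \<Longrightarrow> reflected (leq t u)"
  unfolding leq_def by (intro reflected_Exists reflected_Equal) simp_all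

lemma reflected_lt: "wf_tm F t \<Longrightarrow> wf_tm F u \<Longrightarrow> reflected (lt t u)"
  unfolding lt_def by (intro reflected_leq) simp_all

definition all_below :: "fm \<Rightarrow> fm" where
  "all_below \<phi> = Forall (Impl (lt (Var 0) (Var 1)) (subst (up (\<lambda>i. Var (Suc i))) \<phi>))"

lemma wf_all_below [simp]: "wf_fm F (all_below \<phi>) = wf_fm F \<phi>"
  by (simp add: all_below_def)

lemma sat_all_below [simp]:
  "sat M' e (all_below \<phi>) \<longleftrightarrow> (\<forall>a. a \<prec>\<^bsub>M'\<^esub> e 0 \<longrightarrow> sat M' (case_nat a (\<lambda>i. e (Suc i))) \<phi>)"
  by (simp add: all_below_def sat_subst val_up)

lemma inst_all_below: "inst (all_below \<phi>) t = Forall (Impl (lt (Var 0) (lift_tm t)) \<phi>)"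
proof -
  have "subst (up (case_nat t Var)) (subst (up (\<lambda>i. Var (Suc i))) \<phi>) = \<phi>"
    by (simp add: subst_subst flip: up_subst_tm)
  then show ?thesis by (simp add: all_below_def inst_def subst_lt)
qed

text \<open>
  The value of the variable 0 of \<open>\<phi>\<close> is here the bound already reached, so reflecting \<open>\<phi>\<close> once
  raises the bound by one.
\<close>

lemma provable_all_below_succ:
  assumes \<phi>: "reflected \<phi>" "sat M (case_nat a e) \<phi>"
    and \<chi>: "provable (case_nat a e) (Conj (lift \<psi>) (all_below \<phi>))" (is "provable _ ?\<chi>")
  shows "provable (case_nat (\<S> a) e) ?\<chi>"
proof -
  let ?\<sigma> = "case_nat (Succ (Var 0)) (\<lambda>i. Var (Suc i))"
  have "provable (case_nat a e) (Conj ?\<chi> \<phi>)" using \<phi> \<chi> by (rule reflectedD)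
  then have "provable (case_nat a e) (subst ?\<sigma> ?\<chi>)"
  proof (rule provable_mono)
    show "pa_entails F (Conj ?\<chi> \<phi>) (subst ?\<sigma> ?\<chi>)"
      by (rule pa_entailsI) (auto simp: sat_subst val_case_nat pa_model.less_succ_iff)
  qed (use provable_imp_wf[OF \<chi>] in simp)
  then show ?thesis by (rule provable_substD) simp_all
qed

lemma reflected_all_below:
  assumes "reflected \<phi>"
  shows "reflected (all_below \<phi>)"
proof -
  have wf: "wf_fm F \<phi>" using assms by (rule reflected_imp_wf)
  have "reflected (subst Var (all_below \<phi>))"
  proof (rule reflected_substI[where m = 1])
    fix \<psi> e assume sat: "sat M e (all_below \<phi>)" and "provable (\<lambda>i. e (i + 1)) \<psi>"
    then have \<psi>: "provable (\<lambda>i. e (Suc i)) \<psi>" by simp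
    let ?d = "\<lambda>i. e (Suc i)" and ?\<chi> = "Conj (lift \<psi>) (all_below \<phi>)"
    have wf_\<chi>: "wf_fm F ?\<chi>" using wf provable_imp_wf[OF \<psi>] by simp
    have "provable (case_nat (e 0) ?d) ?\<chi>"
    proof (rule provable_induct[where \<sigma> = Var and \<psi> = "all_below \<phi>" and e = ?d
          and E = "\<lambda>a. case_nat a ?d"])
      have "provable ?d (inst ?\<chi> Zero)"
        using \<psi> by (rule provable_mono)
          (use wf_\<chi> in \<open>simp_all add: pa_entails_def pa_model.not_less_zero\<close>)
      then show "provable (case_nat \<zero> ?d) ?\<chi>"
        unfolding inst_def by (rule provable_substD) simp_all
    next
      fix a assume "sat M (case_nat a ?d) (all_below \<phi>) \<Longrightarrow> provable (case_nat a ?d) ?\<chi>"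
        and "sat M (case_nat (\<S> a) ?d) (all_below \<phi>)"
      then show "provable (case_nat (\<S> a) ?d) ?\<chi>"
        by (intro provable_all_below_succ assms) (simp_all add: less_succ_iff)
    qed (use sat wf wf_\<chi> in simp_all)
    then show "provable e (Conj (subst (\<lambda>i. Var (i + 1)) \<psi>) (all_below \<phi>))" by (simp add: lift_def)
  qed (use wf in simp_all)
  then show ?thesis by simp
qed

lemma reflected_Forall_lt:
  assumes "reflected \<phi>" "wf_tm F t"
  shows "reflected (Forall (Impl (lt (Var 0) (lift_tm t)) \<phi>))"
  using reflected_inst[OF reflected_all_below[OF assms(1)] wf_imp_evaluated[OF assms(2)]]
  by (simp only: inst_all_below)

definition decided :: "fm \<Rightarrow> bool" where
  "decided \<phi> \<longleftrightarrow> reflected \<phi> \<and> reflected (Neg \<phi>)"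

lemma decided_imp_wf: "decided \<phi> \<Longrightarrow> wf_fm F \<phi>"
  by (simp add: decided_def reflected_imp_wf)

lemma decided_cong:
  assumes "decided \<phi>" "wf_fm F \<psi>"
    and "\<And>(M' :: nat struct) e. pa_model F M' \<Longrightarrow> sat M' e \<psi> \<longleftrightarrow> sat M' e \<phi>"
  shows "decided \<psi>"
proof -
  have "reflected \<psi>" using assms by (auto simp: decided_def pa_entails_def elim!: reflected_cong)
  moreover have "reflected (Neg \<psi>)"
    by (rule reflected_cong[of "Neg \<phi>"]) (use assms in \<open>auto simp: decided_def pa_entails_def\<close>)
  ultimately show ?thesis by (simp add: decided_def)
qed

lemma decidedI:
  assumes "reflected \<phi>" "reflected \<psi>"
    and "\<And>(M' :: nat struct) e. pa_model F M' \<Longrightarrow> sat M' e \<psi> \<longleftrightarrow> \<not> sat M' e \<phi>"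
  shows "decided \<phi>"
proof -
  have "reflected (Neg \<phi>)"
    using assms(2)
    by (rule reflected_cong) (use assms in \<open>auto simp: reflected_imp_wf pa_entails_def\<close>)
  with assms(1) show ?thesis by (simp add: decided_def)
qed

lemma decided_Equal:
  assumes "wf_tm F t" "wf_tm F u"
  shows "decided (Equal t u)"
proof (rule decidedI)
  show "reflected (Disj (lt t u) (lt u t))" using assms by (intro reflected_Disj reflected_lt)
qed (use assms in \<open>auto simp: reflected_Equal pa_model.neq_iff\<close>)

lemma decided_leq:
  assumes "wf_tm F t" "wf_tm F u"
  shows "decided (leq t u)"
  using reflected_leq[OF assms] reflected_lt[OF assms(2,1)]
  by (rule decidedI) (simp add: pa_model.not_le_iff)

lemma decided_lt: "wf_tm F t \<Longrightarrow> wf_tm F u \<Longrightarrow> decided (lt t u)"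
  unfolding lt_def by (intro decided_leq) simp_all

lemma decided_Falsum: "decided Falsum"
proof (rule decidedI)
  show "reflected (Equal Zero Zero)" by (rule reflected_Equal) simp_all
qed (auto intro: reflectedI)

lemma decided_Neg:
  assumes "decided \<phi>"
  shows "decided (Neg \<phi>)"
  by (rule decidedI[of _ \<phi>]) (use assms in \<open>simp_all add: decided_def\<close>)

lemma decided_Conj:
  assumes "decided \<phi>" "decided \<psi>"
  shows "decided (Conj \<phi> \<psi>)"
proof (rule decidedI)
  show "reflected (Disj (Neg \<phi>) (Neg \<psi>))"
    using assms by (intro reflected_Disj) (simp_all add: decided_def)
qed (use assms in \<open>auto simp: decided_def reflected_Conj\<close>)

lemma decided_Disj:
  assumes "decided \<phi>" "decided \<psi>"
  shows "decided (Disj \<phi> \<psi>)"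
proof (rule decided_cong)
  show "decided (Neg (Conj (Neg \<phi>) (Neg \<psi>)))" using assms by (intro decided_Neg decided_Conj)
qed (use assms in \<open>auto simp: decided_imp_wf\<close>)

lemma decided_Impl:
  assumes "decided \<phi>" "decided \<psi>"
  shows "decided (Impl \<phi> \<psi>)"
proof (rule decided_cong)
  show "decided (Disj (Neg \<phi>) \<psi>)" using assms by (intro decided_Neg decided_Disj)
qed (use assms in \<open>auto simp: decided_imp_wf\<close>)

lemma decided_Forall_lt:
  assumes "decided \<phi>" "wf_tm F t"
  shows "decided (Forall (Impl (lt (Var 0) (lift_tm t)) \<phi>))"
proof (rule decidedI)
  show "reflected (Exists (Conj (lt (Var 0) (lift_tm t)) (Neg \<phi>)))"
    using assms by (intro reflected_Exists reflected_Conj reflected_lt) (simp_all add: decided_def)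
qed (use assms in \<open>auto simp: decided_def reflected_Forall_lt\<close>)

lemma decided_Forall_leq:
  assumes "decided \<phi>" "wf_tm F t"
  shows "decided (Forall (Impl (leq (Var 0) (lift_tm t)) \<phi>))"
proof (rule decided_cong)
  show "decided (Forall (Impl (lt (Var 0) (lift_tm (Succ t))) \<phi>))"
    using assms by (intro decided_Forall_lt) simp_all
qed (use assms in \<open>simp_all add: decided_imp_wf pa_model.less_succ_iff_le\<close>)

lemma decided_Exists_lt:
  assumes "decided \<phi>" "wf_tm F t"
  shows "decided (Exists (Conj (lt (Var 0) (lift_tm t)) \<phi>))"
proof (rule decided_cong)
  show "decided (Neg (Forall (Impl (lt (Var 0) (lift_tm t)) (Neg \<phi>))))"
    using assms by (intro decided_Neg decided_Forall_lt)
qed (use assms in \<open>auto simp: decided_imp_wf\<close>)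

lemma decided_Exists_leq:
  assumes "decided \<phi>" "wf_tm F t"
  shows "decided (Exists (Conj (leq (Var 0) (lift_tm t)) \<phi>))"
proof (rule decided_cong)
  show "decided (Neg (Forall (Impl (leq (Var 0) (lift_tm t)) (Neg \<phi>))))"
    using assms by (intro decided_Neg decided_Forall_leq)
qed (use assms in \<open>auto simp: decided_imp_wf\<close>)

lemma decided_Delta0: "Delta0 \<phi> \<Longrightarrow> wf_fm F \<phi> \<Longrightarrow> decided \<phi>"
  by (induction rule: Delta0.induct)
    (simp_all add: decided_Equal decided_leq decided_lt decided_Falsum decided_Conj decided_Disj
      decided_Impl decided_Forall_leq decided_Forall_lt decided_Exists_leq decided_Exists_lt)

lemma reflected_Sigma1: "Sigma1 \<phi> \<Longrightarrow> wf_fm F \<phi> \<Longrightarrow> reflected \<phi>"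
proof (induction rule: Sigma1.induct)
  case (1 \<phi>)
  then show ?case using decided_Delta0 by (simp add: decided_def)
next
  case (2 \<phi>)
  then show ?case by (simp add: reflected_Exists)
qed

lemma provable_Sigma1:
  assumes "Sigma1 \<phi>" "wf_fm F \<phi>" "sat M e \<phi>" and \<psi>: "provable e \<psi>"
  shows "provable e \<phi>"
proof -
  have "provable e (Conj \<psi> \<phi>)" using reflected_Sigma1[OF assms(1,2)] assms(3) \<psi> by (rule reflectedD)
  then show ?thesis by (rule provable_mono) (use assms in \<open>simp_all add: pa_entails_def\<close>)
qed

end


section \<open>Derivability conditions in models\<close>

lemma pa_entails_imp_deriv_alls:
  assumes "admissible F" "is_theory F T" "extends F T (PA F)"
    and "wf_fm F \<phi>" "wf_fm F \<psi>" "pa_entails F \<phi> \<psi>"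
  shows "deriv F T (alls n (Impl \<phi> \<psi>))"
proof (rule completeness[OF assms(2,3)])
  fix M :: "nat struct" and e assume "models M T"
  then have "pa_model F M" by (rule models_imp_pa_model[OF assms(1,3)])
  then have "\<forall>e. sat M e (Impl \<phi> \<psi>)" using assms(6) by (simp add: pa_entails_def)
  then show "sat M e (alls n (Impl \<phi> \<psi>))" using all_sat_alls by blast
qed (use assms in simp)

lemma B2U_imp_provability_formula:
  fixes M :: "nat struct"
  assumes F: "admissible F" and T: "is_theory F T" "extends F T (PA F)" and B2U: "B2U F S T \<Phi>"
    and \<Phi>: "wf_fm F \<Phi>" "fv \<Phi> \<subseteq> {0}" and M: "models M S" "pa_model F M"
  shows "provability_formula F M \<Phi>"
proof -
  interpret pa_model F M by (rule M(2))
  show ?thesis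
  proof unfold_locales
    fix \<phi> \<psi> e assume wf: "wf_fm F \<phi>" "wf_fm F \<psi>" and entails: "pa_entails F \<phi> \<psi>"
    obtain n where "fv (Conj \<phi> \<psi>) \<subseteq> {..<n}" by (rule fv_bounded)
    then have "deriv F S (alls n (Impl (inst \<Phi> (dot_quote \<phi>)) (inst \<Phi> (dot_quote \<psi>))))"
      using B2U wf pa_entails_imp_deriv_alls[OF F T wf entails] by (simp add: B2U_def)
    then have "\<forall>e. sat M e (alls n (Impl (inst \<Phi> (dot_quote \<phi>)) (inst \<Phi> (dot_quote \<psi>))))"
      using models_deriv[OF M(1)] by blast
    then have "sat M e (Impl (inst \<Phi> (dot_quote \<phi>)) (inst \<Phi> (dot_quote \<psi>)))"
      unfolding all_sat_alls by blast
    then show "sat M e (inst \<Phi> (dot_quote \<phi>)) \<Longrightarrow> sat M e (inst \<Phi> (dot_quote \<psi>))" by simp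
  qed (use \<Phi> in simp_all)
qed

lemma (in provability_formula) D1_imp_provable:
  assumes "D1 F S T \<Phi>" "models M S" and \<phi>: "deriv F T \<phi>" "fv \<phi> = {}"
  shows "provable e \<phi>"
proof -
  have "deriv F S (inst \<Phi> (quote \<phi>))" using assms(1) \<phi>(1) by (simp add: D1_def deriv_imp_wf)
  then have "sat M e (inst \<Phi> (quote \<phi>))" by (rule models_deriv[OF assms(2)])
  then show ?thesis using \<phi> by (simp add: provable_def deriv_imp_wf val_dot_quote_sentence)
qed

theorem theorem2p20:
  fixes F :: "pfun set" and S T :: "fm set" and \<Phi> :: fm
  assumes "admissible F"
    and "is_theory F S" and "recursively_axiomatized S" and "consistent F S" and "extends F S (PA F)"
    and "is_theory F T" and "recursively_axiomatized T" and "consistent F T" and "extends F T (PA F)"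
    and "extends F T S"
    and "wf_fm F \<Phi>" and "fv \<Phi> = {0}"
    and "D1 F S T \<Phi>"
    and "B2U F S T \<Phi>"
  shows "Sigma1_CU F S \<Phi>"
  unfolding Sigma1_CU_def
proof (intro allI impI)
  fix n \<phi> assume \<phi>: "wf_fm F \<phi>" "Sigma1 \<phi>"
  show "deriv F S (alls n (Impl \<phi> (inst \<Phi> (dot_quote \<phi>))))"
  proof (rule completeness[OF assms(2,5)])
    fix M :: "nat struct" and e assume M: "models M S"
    then have "pa_model F M" by (rule models_imp_pa_model[OF assms(1,5)])
    with M interpret provability_formula F M \<Phi>
      using assms by (intro B2U_imp_provability_formula) simp_all
    have "deriv F T (Neg Falsum)" by (rule deriv.ImplI[OF deriv.Assm]) simp_all
    with assms(13) M have top: "provable e (Neg Falsum)" for e by (rule D1_imp_provable) simp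
    have "provable e \<phi>" if "sat M e \<phi>" for e using \<phi>(2,1) that top by (rule provable_Sigma1)
    then have "\<forall>e. sat M e (Impl \<phi> (inst \<Phi> (dot_quote \<phi>)))" by (simp add: provable_def)
    then show "sat M e (alls n (Impl \<phi> (inst \<Phi> (dot_quote \<phi>))))" using all_sat_alls by blast
  qed (use \<phi> assms(1,11) in \<open>simp add: wf_dot_quote\<close>)
qed

end
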